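(* Let $(X,\|\cdot\|)$ be a reflexive Banach space such that $X$ and its dual $(X^*,\|\cdot\|_* )$ are strictly convex and smooth. Let $p>1$, let $p^*=p/(p-1)$, and let $\varepsilon>0$. Let $f:X\to(-\infty,+\infty]$ be a proper, lower semicontinuous, and convex functional, and for $\varepsilon>0$ let $$f_\varepsilon(u)=\inf_{v\in X}\left\{\frac{\varepsilon}{p}\left\|\frac{u-v}{\varepsilon}\right\|^p+f(v)\right\}=\inf_{v\in X}\left\{\frac{1}{p\varepsilon^{p-1}}\|u-v\|^p+f(v)\right\},\qquad u\in X,$$ be its $p$-Moreau--Yosida regularization. Then the following hold. (1) $f_\varepsilon$ is convex and locally Lipschitz continuous on $X$; if $f$ is strictly convex, then so is $f_\varepsilon$. (2) For every $u\in X$ the infimum defining $f_\varepsilon(u)$ is attained at a unique minimizer $$u_\varepsilon=J_\varepsilon(u):=\operatorname{argmin}_{v\in X}\left\{\frac{1}{p\varepsilon^{p-1}}\|u-v\|^p+f(v)\right\},$$ and $u_\varepsilon$ satisfies the Euler--Lagrange equation $$0\in F_X^p\left(\frac{u_\varepsilon-u}{\varepsilon}\right)+\partial f(u_\varepsilon).$$ (3) $f_\varepsilon$ is Gâteaux differentiable at every $u\in X$, its Gâteaux derivative $A_\varepsilon:X\to X^*$ is demicontinuous on $X$, and $A_\varepsilon(u)=-F_X^p\left(\frac{u_\varepsilon-u}{\varepsilon}\right)$ for every $u\in X$. If $X^*$ is uniformly convex, then $A_\varepsilon$ is continuous. (4) Moreover: i) $f_\varepsilon(u)=\frac{\varepsilon}{p}\|A_\varepsilon(u)\|_*^{p^*}+f(u_\varepsilon)$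 for every $u\in X$; ii) $f(u_{\varepsilon_1})\le f_{\varepsilon_1}(u)\le f_{\varepsilon_2}(u)\le f(u)$ for all $u\in X$ and all $\varepsilon_1\ge\varepsilon_2>0$; iii) $\lim_{\varepsilon\to0}\|u_\varepsilon-u\|=0$ for all $u\in\operatorname{dom}(f)$; iv) $\lim_{\varepsilon\to0}f_\varepsilon(u)=f(u)$ for every $u\in X$; v) for each $u\in\operatorname{dom}(\partial f)$, $A_\varepsilon(u)\rightharpoonup A_0(u)\in\partial f(u)$ weakly in $X^*$ as $\varepsilon\to0$, where $A_0(u):=\operatorname{argmin}\{\|\xi\|_*:\xi\in\partial f(u)\}$; if $X^*$ is uniformly convex, then $A_\varepsilon(u)\to A_0(u)$ strongly in $X^*$ as $\varepsilon\to0$. (5) For every $u\in X$ the mapping $\varepsilon\mapsto f_\varepsilon(u)$ is differentiable on $(0,+\infty)$ with $$\frac{d}{d\varepsilon}f_\varepsilon(u)=-\frac{1}{p^*\varepsilon^p}\|u_\varepsilon-u\|^p\qquad\text{for all }\varepsilon>0.$$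
   Context: Spaces are real; $\langle\cdot,\cdot\rangle$ is the duality pairing between $X^*$ and $X$. For $f:X\to(-\infty,+\infty]$: $\operatorname{dom}(f)=\{u\in X: f(u)<+\infty\}$; $f$ is proper if $\operatorname{dom}(f)\ne\emptyset$; the subdifferential is $\partial f(u)=\{\xi\in X^*: f(u)-f(v)\le\langle\xi,u-v\rangle\text{ for all }v\in X\}$, where $u \in \operatorname{dom}(f)$ (and $\partial f(u)=\emptyset$ if $f(u)=+\infty$), and $\operatorname{dom}(\partial f)=\{u\in X:\partial f(u)\neq\emptyset\}$. A functional $f$ is strictly convex if $f(tx+(1-t)y)<tf(x)+(1-t)f(y)$ for all distinct $x,y\in\operatorname{dom}(f)$ and $t\in(0,1)$. A normed space is strictly convex if its norm is strictly convex, i.e. $\|x\|=\|y\|=1$ and $x\ne y$ imply $\|tx+(1-t)y\|<1$ for all $t\in(0,1)$. The norm of $X$ is called smooth if the duality map $F_X(v)=\{\xi\in X^*:\langle\xi,v\rangle=\|v\|^2=\|\xi\|_*^2\}$ is single-valued. The assumption on $X$ and $X^*$ is that the given norms $\|\cdot\|$ and $\|\cdot\|_*$ are strictly convex and smooth. The $p$-duality map is $F_X^p:=\partial\left(\frac1p\|\cdot\|^p\right)$; equivalently $F_X^p(u)=\{\xi\in X^*:\langle\xi,u\rangle=\|u\|^p=\|\xi\|_*^{p^*}\}$. Under the present assumptions it is single-valued and is identified with a map $X\to X^*$. A map $A:X\to X^*$ is demicontinuous if it is continuous from the strong topology of $X$ to the weak* topology of $X^*$ (which is the weak topology, since $X$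 is reflexive). A normed space $Y$ is uniformly convex if for every $0<\eta\le2$ there is $\delta>0$ such that $\|x\|=\|y\|=1$ and $\|x-y\|\ge\eta$ imply $\left\|\frac{x+y}{2}\right\|\le1-\delta$. *)

theory Defs
  imports "HOL-Analysis.Analysis"
begin

text \<open>
  The dual of a real normed space \<open>'a\<close> is the type \<open>'a \<Rightarrow>\<^sub>L real\<close> of bounded linear functionals
  with the operator norm, and the duality pairing is application. Extended-valued functionals
  have type \<open>'a \<Rightarrow> ereal\<close>; that they omit the value \<open>-\<infinity>\<close> is stated separately.
\<close>

subsection \<open>Geometry of normed spaces\<close>

text \<open>Surjectivity of the canonical embedding into the bidual.\<close>

definition reflexive_space :: "'a::real_normed_vector itself \<Rightarrow> bool" where
  "reflexive_space _ \<longleftrightarrow>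
     (\<forall>\<Phi> :: ('a \<Rightarrow>\<^sub>L real) \<Rightarrow>\<^sub>L real. \<exists>x::'a. \<forall>\<xi>. blinfun_apply \<Phi> \<xi> = blinfun_apply \<xi> x)"

definition strictly_convex_space :: "'a::real_normed_vector itself \<Rightarrow> bool" where
  "strictly_convex_space _ \<longleftrightarrow>
     (\<forall>x y :: 'a. norm x = 1 \<and> norm y = 1 \<and> x \<noteq> y \<longrightarrow>
        (\<forall>t\<in>{0<..<1}. norm (t *\<^sub>R x + (1 - t) *\<^sub>R y) < 1))"

definition uniformly_convex_space :: "'a::real_normed_vector itself \<Rightarrow> bool" where
  "uniformly_convex_space _ \<longleftrightarrow>
     (\<forall>\<eta>::real. 0 < \<eta> \<and> \<eta> \<le> 2 \<longrightarrow>
        (\<exists>\<delta>>0. \<forall>x y :: 'a. norm x = 1 \<and> norm y = 1 \<and> norm (x - y) \<ge> \<eta> \<longrightarrow>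
           norm ((x + y) /\<^sub>R 2) \<le> 1 - \<delta>))"

definition duality_map :: "'a::real_normed_vector \<Rightarrow> ('a \<Rightarrow>\<^sub>L real) set" where
  "duality_map v = {\<xi>. blinfun_apply \<xi> v = (norm v)\<^sup>2 \<and> (norm v)\<^sup>2 = (norm \<xi>)\<^sup>2}"

definition smooth_space :: "'a::real_normed_vector itself \<Rightarrow> bool" where
  "smooth_space _ \<longleftrightarrow> (\<forall>v::'a. \<exists>!\<xi>. \<xi> \<in> duality_map v)"

subsection \<open>Extended-valued functionals\<close>

definition eff_dom :: "('a \<Rightarrow> ereal) \<Rightarrow> 'a set" where
  "eff_dom f = {u. f u < \<infinity>}"

definition proper_fun :: "('a \<Rightarrow> ereal) \<Rightarrow> bool" where
  "proper_fun f \<longleftrightarrow> eff_dom f \<noteq> {}"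

definition convex_fun :: "('a::real_vector \<Rightarrow> ereal) \<Rightarrow> bool" where
  "convex_fun f \<longleftrightarrow>
     (\<forall>x y. \<forall>t\<in>{0<..<1}. f (t *\<^sub>R x + (1 - t) *\<^sub>R y) \<le> ereal t * f x + ereal (1 - t) * f y)"

definition strictly_convex_fun :: "('a::real_vector \<Rightarrow> ereal) \<Rightarrow> bool" where
  "strictly_convex_fun f \<longleftrightarrow>
     (\<forall>x\<in>eff_dom f. \<forall>y\<in>eff_dom f. x \<noteq> y \<longrightarrow>
        (\<forall>t\<in>{0<..<1}. f (t *\<^sub>R x + (1 - t) *\<^sub>R y) < ereal t * f x + ereal (1 - t) * f y))"

definition lower_semicontinuous :: "('a::topological_space \<Rightarrow> ereal) \<Rightarrow> bool" where
  "lower_semicontinuous f \<longleftrightarrow> (\<forall>u. \<forall>c < f u. \<forall>\<^sub>F v in nhds u. c < f v)"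

definition subdifferential :: "('a::real_normed_vector \<Rightarrow> ereal) \<Rightarrow> 'a \<Rightarrow> ('a \<Rightarrow>\<^sub>L real) set" where
  "subdifferential f u =
     {\<xi>. u \<in> eff_dom f \<and> (\<forall>v. f u - f v \<le> ereal (blinfun_apply \<xi> (u - v)))}"

definition subdiff_dom :: "('a::real_normed_vector \<Rightarrow> ereal) \<Rightarrow> 'a set" where
  "subdiff_dom f = {u. subdifferential f u \<noteq> {}}"

definition p_duality_map :: "real \<Rightarrow> 'a::real_normed_vector \<Rightarrow> ('a \<Rightarrow>\<^sub>L real) set" where
  "p_duality_map p = subdifferential (\<lambda>u. ereal (1 / p * norm u powr p))"

subsection \<open>Regularity of real-valued functionals and weak topologies\<close>

definition locally_lipschitz :: "('a::metric_space \<Rightarrow> real) \<Rightarrow> bool" where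
  "locally_lipschitz g \<longleftrightarrow> (\<forall>u. \<exists>r>0. \<exists>L. L-lipschitz_on (ball u r) g)"

definition has_gateaux_derivative ::
  "('a::real_normed_vector \<Rightarrow> real) \<Rightarrow> ('a \<Rightarrow>\<^sub>L real) \<Rightarrow> 'a \<Rightarrow> bool" where
  "has_gateaux_derivative g \<xi> u \<longleftrightarrow>
     (\<forall>h. ((\<lambda>t. g (u + t *\<^sub>R h)) has_real_derivative blinfun_apply \<xi> h) (at 0))"

definition gateaux_derivative :: "('a::real_normed_vector \<Rightarrow> real) \<Rightarrow> 'a \<Rightarrow> ('a \<Rightarrow>\<^sub>L real)" where
  "gateaux_derivative g u = (THE \<xi>. has_gateaux_derivative g \<xi> u)"

text \<open>For real-valued functionals the strong operator topology is the weak* topology.\<close>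

definition demicontinuous :: "('a::real_normed_vector \<Rightarrow> ('a \<Rightarrow>\<^sub>L real)) \<Rightarrow> bool" where
  "demicontinuous A \<longleftrightarrow> continuous_map euclidean strong_operator_topology A"

definition weakly_tendsto :: "('b \<Rightarrow> 'a::real_normed_vector) \<Rightarrow> 'a \<Rightarrow> 'b filter \<Rightarrow> bool" where
  "weakly_tendsto x l F \<longleftrightarrow>
     (\<forall>\<phi> :: 'a \<Rightarrow>\<^sub>L real. ((\<lambda>i. blinfun_apply \<phi> (x i)) \<longlongrightarrow> blinfun_apply \<phi> l) F)"

subsection \<open>The Moreau--Yosida regularization\<close>

definition moreau_yosida ::
  "real \<Rightarrow> ('a::real_normed_vector \<Rightarrow> ereal) \<Rightarrow> real \<Rightarrow> 'a \<Rightarrow> ereal" where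
  "moreau_yosida p f \<epsilon> u = (INF v. ereal (\<epsilon> / p * norm ((u - v) /\<^sub>R \<epsilon>) powr p) + f v)"

definition my_objective ::
  "real \<Rightarrow> ('a::real_normed_vector \<Rightarrow> ereal) \<Rightarrow> real \<Rightarrow> 'a \<Rightarrow> 'a \<Rightarrow> ereal" where
  "my_objective p f \<epsilon> u v = ereal (1 / (p * \<epsilon> powr (p - 1)) * norm (u - v) powr p) + f v"

text \<open>
  The choice operator \<^const>\<open>arg_min\<close> denotes the minimizer only where one exists; existence and
  uniqueness are therefore to be asserted separately.
\<close>

definition my_resolvent ::
  "real \<Rightarrow> ('a::real_normed_vector \<Rightarrow> ereal) \<Rightarrow> real \<Rightarrow> 'a \<Rightarrow> 'a" where
  "my_resolvent p f \<epsilon> u = arg_min (my_objective p f \<epsilon> u) (\<lambda>_. True)"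

text \<open>
  \<^const>\<open>real_of_ereal\<close> sends infinite values to 0, so this is meaningful only once the
  regularization is known to be finite.
\<close>

definition my_derivative ::
  "real \<Rightarrow> ('a::real_normed_vector \<Rightarrow> ereal) \<Rightarrow> real \<Rightarrow> 'a \<Rightarrow> ('a \<Rightarrow>\<^sub>L real)" where
  "my_derivative p f \<epsilon> = gateaux_derivative (\<lambda>w. real_of_ereal (moreau_yosida p f \<epsilon> w))"

definition minimal_subgradient ::
  "('a::real_normed_vector \<Rightarrow> ereal) \<Rightarrow> 'a \<Rightarrow> ('a \<Rightarrow>\<^sub>L real)" where
  "minimal_subgradient f u = arg_min norm (\<lambda>\<xi>. \<xi> \<in> subdifferential f u)"

end

theory Submission
  imports Defs
begin

text \<open>
  Minimizers exist by weak compactness of balls (Banach--Alaoglu and reflexivity) and Mazur's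
  theorem that closed convex sets are weakly closed; they are unique because the \<open>p\<close>-th power of
  the norm is strictly convex. Smoothness makes the penalty Gateaux differentiable, so the first
  order condition at \<open>J \<epsilon> u\<close> says that the derivative of the penalty at \<open>u - J \<epsilon> u\<close> is a subgradient
  of \<open>f\<close> at \<open>J \<epsilon> u\<close>, and hence also a subgradient of the envelope at \<open>u\<close>. A Fenchel--Young argument
  shows that these subgradients depend weak* continuously, with continuous norms, on \<open>(\<epsilon>, u)\<close>; this
  gives differentiability and demicontinuity, strong continuity via the Radon--Riesz property, and
  the derivative in \<open>\<epsilon>\<close> by the envelope theorem. As \<open>\<epsilon> \<rightarrow> 0\<close> the gradients at \<open>u\<close> are bounded by every
  subgradient of \<open>f\<close> at \<open>u\<close>, so each of their weak* cluster points is the one of least norm.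
\<close>

subsection \<open>Weak compactness and separation\<close>

text \<open>Limits are taken along filters throughout. Without separability, balls of the dual need
  not be weak* sequentially compact, so a finer nontrivial filter takes the place of a subsequence;
  the same statements then cover \<open>at_right 0\<close>, neighbourhoods of \<open>u\<close>, and
  joint limits in both variables. The obstacle is that strict convexity of the space gives no norm
  convergence of the resolvents, so continuity of the gradient is not obtained by passing to the
  limit in the duality map of the residuals. The argument stays on the dual side instead. The
  gradient at \<open>u\<close> is a subgradient of both terms of an infimal convolution, and the
  conjugate of the penalty at this gradient is p - 1 times the penalty of the residual. Convergence
  of the conjugate values therefore returns convergence of the residual norms, which is what strong
  continuity of the gradient and the derivative in \<epsilon> call for. Reflexivity acts in two
  places: it yields weak cluster points of minimizing sequences, and it turns weak* convergence of
  the gradients into weak convergence.\<close>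

text \<open>The cluster point that compactness gives for the image filter becomes a limit after
  intersecting \<open>F\<close> with the pullback of the neighbourhoods of \<open>x\<close>.
  Nontriviality of this intersection is precisely the cluster property.\<close>

lemma cluster_filter:
  assumes "compact K" and "F \<noteq> bot" and "eventually (\<lambda>i. e i \<in> K) F"
  obtains G x where "G \<le> F" "G \<noteq> bot" "x \<in> K" "(e \<longlongrightarrow> x) G"
proof -
  have "filtermap e F \<noteq> bot" "eventually (\<lambda>y. y \<in> K) (filtermap e F)"
    using assms by (auto simp: filtermap_bot_iff eventually_filtermap)
  then obtain x where x: "x \<in> K" "inf (nhds x) (filtermap e F) \<noteq> bot"
    using \<open>compact K\<close> unfolding compact_filter by blast
  define G where "G = inf F (filtercomap e (nhds x))"
  have "G \<noteq> bot"
  proof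
    assume "G = bot"
    then have "eventually (\<lambda>_. False) G"
      by simp
    then obtain P Q where PQ: "eventually P F" "eventually Q (filtercomap e (nhds x))"
        "\<And>i. P i \<Longrightarrow> Q i \<Longrightarrow> False"
      unfolding G_def eventually_inf by blast
    then obtain R where R: "eventually R (nhds x)" "\<And>i. R (e i) \<Longrightarrow> Q i"
      unfolding eventually_filtercomap by blast
    have "eventually (\<lambda>y. \<not> R y) (filtermap e F)"
      using PQ(1) unfolding eventually_filtermap by eventually_elim (use PQ R in blast)
    with R(1) have "eventually (\<lambda>_. False) (inf (nhds x) (filtermap e F))"
      unfolding eventually_inf by blast
    with x(2) show False
      by (simp add: trivial_limit_def)
  qed
  moreover have "(e \<longlongrightarrow> x) G"
    unfolding G_def filterlim_def
    by (meson filtermap_le_iff_le_filtercomap inf.cobounded2)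
  ultimately show ?thesis
    using that x(1) by (metis G_def inf.cobounded1)
qed

text \<open>Tychonoff: a functional of norm at most \<open>M\<close> is a point of the product
  \<open>K\<close> of intervals, where convergence is pointwise. Linearity and the bound are closed
  conditions and survive in the limit.\<close>

lemma banach_alaoglu_filter:
  fixes \<xi> :: "'i \<Rightarrow> ('a::real_normed_vector \<Rightarrow>\<^sub>L real)"
  assumes F: "F \<noteq> bot" and bd: "eventually (\<lambda>i. norm (\<xi> i) \<le> M) F"
  obtains G \<zeta> where "G \<le> F" "G \<noteq> bot" "norm \<zeta> \<le> M"
    "\<And>x. ((\<lambda>i. blinfun_apply (\<xi> i) x) \<longlongrightarrow> blinfun_apply \<zeta> x) G"
proof -
  define K where "K = (\<Pi>\<^sub>E x\<in>(UNIV::'a set). cball (0::real) (M * norm x))"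
  have "compact K"
  proof -
    have "compactin (product_topology (\<lambda>_. euclidean) UNIV) K"
      unfolding K_def compactin_PiE by simp
    then show ?thesis
      by (simp add: euclidean_product_topology)
  qed
  moreover have "eventually (\<lambda>i. blinfun_apply (\<xi> i) \<in> K) F"
    using bd
  proof eventually_elim
    case (elim i)
    then have "\<bar>blinfun_apply (\<xi> i) x\<bar> \<le> M * norm x" for x
      using norm_blinfun[of "\<xi> i" x] mult_right_mono[of "norm (\<xi> i)" M "norm x"] by force
    then show ?case
      by (auto simp: K_def PiE_UNIV_domain)
  qed
  ultimately obtain G \<Phi> where G: "G \<le> F" "G \<noteq> bot" "\<Phi> \<in> K"
      "((\<lambda>i. blinfun_apply (\<xi> i)) \<longlongrightarrow> \<Phi>) G"
    using cluster_filter[OF _ F, of K "\<lambda>i. blinfun_apply (\<xi> i)"] by blast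
  have lim: "((\<lambda>i. blinfun_apply (\<xi> i) x) \<longlongrightarrow> \<Phi> x) G" for x
    using continuous_on_tendsto_compose[OF continuous_on_product_coordinates G(4), of x] by simp
  have bnd: "\<bar>\<Phi> x\<bar> \<le> norm x * M" for x
    using G(3) by (auto simp: K_def PiE_UNIV_domain dist_real_def mult.commute)
  have "\<Phi> (x + y) = \<Phi> x + \<Phi> y" for x y
    using tendsto_add[OF lim[of x] lim[of y]] lim[of "x + y"] G(2)
    by (simp add: blinfun.add_right tendsto_unique)
  moreover have "\<Phi> (r *\<^sub>R x) = r *\<^sub>R \<Phi> x" for r x
    using tendsto_mult_left[OF lim[of x], of r] lim[of "r *\<^sub>R x"] G(2)
    by (simp add: blinfun.scaleR_right tendsto_unique)
  ultimately have "bounded_linear \<Phi>"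
    by (intro bounded_linear_intro[where K = M]) (use bnd in auto)
  then have app: "blinfun_apply (Blinfun \<Phi>) = \<Phi>"
    by (rule bounded_linear_Blinfun_apply)
  \<comment> \<open>Nontriviality of \<open>F\<close> supplies an actual index;
    \<open>norm_blinfun_bound\<close> asks for a nonnegative constant.\<close>
  have "0 \<le> M"
    using eventually_happens'[OF F bd] norm_ge_zero order_trans by blast
  then have "norm (Blinfun \<Phi>) \<le> M"
    by (intro norm_blinfun_bound) (use bnd in \<open>auto simp: app mult.commute\<close>)
  then show ?thesis
    using that[of G "Blinfun \<Phi>"] G lim by (simp add: app)
qed

text \<open>Subnet principle. If convergence failed at \<open>x\<close>, restricting
  \<open>F\<close> to the indices whose value at \<open>x\<close> stays outside an open set would
  leave a nontrivial filter, and its cluster point could not be \<zeta>.\<close>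

lemma weak_star_limit_unique_cluster:
  fixes \<xi> :: "'i \<Rightarrow> ('a::real_normed_vector \<Rightarrow>\<^sub>L real)"
  assumes bd: "eventually (\<lambda>i. norm (\<xi> i) \<le> M) F"
    and cl: "\<And>G \<eta>. G \<le> F \<Longrightarrow> G \<noteq> bot \<Longrightarrow>
      (\<And>x. ((\<lambda>i. blinfun_apply (\<xi> i) x) \<longlongrightarrow> blinfun_apply \<eta> x) G) \<Longrightarrow> norm \<eta> \<le> M \<Longrightarrow> \<eta> = \<zeta>"
  shows "((\<lambda>i. blinfun_apply (\<xi> i) x) \<longlongrightarrow> blinfun_apply \<zeta> x) F"
proof (rule ccontr)
  assume "\<not> ?thesis"
  then obtain S where S: "open S" "blinfun_apply \<zeta> x \<in> S"
      "\<not> eventually (\<lambda>i. blinfun_apply (\<xi> i) x \<in> S) F"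
    unfolding tendsto_def by blast
  define H where "H = inf F (principal {i. blinfun_apply (\<xi> i) x \<notin> S})"
  have "H \<noteq> bot"
    using S(3) by (auto simp: H_def trivial_limit_def eventually_inf_principal)
  moreover have "eventually (\<lambda>i. norm (\<xi> i) \<le> M) H"
    using bd filter_leD[of H F] by (simp add: H_def)
  ultimately obtain G \<eta> where G: "G \<le> H" "G \<noteq> bot" "norm \<eta> \<le> M"
      "\<And>x. ((\<lambda>i. blinfun_apply (\<xi> i) x) \<longlongrightarrow> blinfun_apply \<eta> x) G"
    using banach_alaoglu_filter by blast
  moreover have "G \<le> F"
    using G(1) by (simp add: H_def)
  ultimately have "\<eta> = \<zeta>"
    using cl by blast
  with G(4)[of x] S have "eventually (\<lambda>i. blinfun_apply (\<xi> i) x \<in> S) G"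
    unfolding tendsto_def by blast
  moreover have "eventually (\<lambda>i. blinfun_apply (\<xi> i) x \<notin> S) G"
    using G(1) by (auto simp: H_def le_principal)
  ultimately have "eventually (\<lambda>_. False) G"
    by eventually_elim auto
  with G(2) show False
    by (simp add: trivial_limit_def)
qed

text \<open>Banach-Alaoglu for the bidual, applied to the evaluations \<open>ev (v i)\<close>;
  reflexivity pulls the cluster point back to the space.\<close>

lemma weak_cluster_reflexive:
  fixes v :: "'i \<Rightarrow> 'a::real_normed_vector"
  assumes refl: "reflexive_space TYPE('a)" and F: "F \<noteq> bot"
    and bd: "eventually (\<lambda>i. norm (v i) \<le> M) F"
  obtains G w where "G \<le> F" "G \<noteq> bot"
    "\<And>\<xi> :: 'a \<Rightarrow>\<^sub>L real. ((\<lambda>i. blinfun_apply \<xi> (v i)) \<longlongrightarrow> blinfun_apply \<xi> w) G"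
proof -
  define ev :: "'a \<Rightarrow> (('a \<Rightarrow>\<^sub>L real) \<Rightarrow>\<^sub>L real)" where "ev x = Blinfun (\<lambda>\<xi>. blinfun_apply \<xi> x)" for x
  have ev: "blinfun_apply (ev x) \<xi> = blinfun_apply \<xi> x" for x \<xi>
    unfolding ev_def by (simp add: bounded_linear_Blinfun_apply blinfun.bounded_linear_left)
  have "norm (ev x) \<le> norm x" for x
  proof (rule norm_blinfun_bound)
    show "norm (blinfun_apply (ev x) \<xi>) \<le> norm x * norm \<xi>" for \<xi>
      using norm_blinfun[of \<xi> x] by (simp add: ev mult.commute)
  qed simp
  then have "eventually (\<lambda>i. norm (ev (v i)) \<le> M) F"
    using bd by (auto elim!: eventually_mono intro: order_trans)
  then obtain G \<Phi> where G: "G \<le> F" "G \<noteq> bot"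
      "\<And>\<xi>. ((\<lambda>i. blinfun_apply (ev (v i)) \<xi>) \<longlongrightarrow> blinfun_apply \<Phi> \<xi>) G"
    using banach_alaoglu_filter[OF F] by metis
  obtain w where "\<And>\<xi>. blinfun_apply \<Phi> \<xi> = blinfun_apply \<xi> w"
    using refl unfolding reflexive_space_def by blast
  with G(3) have "((\<lambda>i. blinfun_apply \<xi> (v i)) \<longlongrightarrow> blinfun_apply \<xi> w) G" for \<xi> :: "'a \<Rightarrow>\<^sub>L real"
    by (simp add: ev)
  with that G(1,2) show ?thesis
    by blast
qed

section \<open>The Hahn-Banach theorem through minimal sublinear functionals\<close>

definition sublinear :: "('a::real_vector \<Rightarrow> real) \<Rightarrow> bool" where
  "sublinear q \<longleftrightarrow> (\<forall>x y. q (x + y) \<le> q x + q y) \<and> (\<forall>c\<ge>0. \<forall>x. q (c *\<^sub>R x) = c * q x)"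

lemma sublinearD:
  assumes "sublinear q"
  shows "q (x + y) \<le> q x + q y" "c \<ge> 0 \<Longrightarrow> q (c *\<^sub>R x) = c * q x" "q 0 = 0" "- q (- x) \<le> q x"
proof -
  show 1: "q (x + y) \<le> q x + q y" and "c \<ge> 0 \<Longrightarrow> q (c *\<^sub>R x) = c * q x" for x y c
    using assms by (auto simp: sublinear_def)
  then show 0: "q 0 = 0"
    by (metis mult_zero_left order_refl scaleR_zero_left)
  show "- q (- x) \<le> q x"
    using 1[of x "- x"] 0 by simp
qed

lemma sublinearI:
  assumes "\<And>x y. q (x + y) \<le> q x + q y" and "\<And>c x. c > 0 \<Longrightarrow> q (c *\<^sub>R x) \<le> c * q x" and "q 0 = 0"
  shows "sublinear q"
  unfolding sublinear_def
proof (intro conjI allI impI)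
  fix c :: real and x
  assume "c \<ge> 0"
  show "q (c *\<^sub>R x) = c * q x"
  proof (cases "c = 0")
    case False
    then have c: "c > 0"
      using \<open>c \<ge> 0\<close> by simp
    have "c * q (inverse c *\<^sub>R (c *\<^sub>R x)) \<le> c * (inverse c * q (c *\<^sub>R x))"
      using assms(2)[of "inverse c" "c *\<^sub>R x"] c by (intro mult_left_mono) auto
    then show ?thesis
      using assms(2)[OF c, of x] c by (simp add: field_simps)
  qed (simp add: assms(3))
qed (rule assms(1))

text \<open>Applied to a minimal sublinear \<open>q\<close>, this gives \<open>q x + q y \<le> q (x + y)\<close>.\<close>

lemma sublinear_shift:
  fixes y :: "'a::real_vector"
  assumes q: "sublinear q"
  defines "r \<equiv> \<lambda>x. INF t\<in>{0..}. q (x + t *\<^sub>R y) - t * q y"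
  shows "sublinear r" "r x \<le> q x" "r x \<le> q (x + y) - q y"
proof -
  note sub = sublinearD[OF q]
  have lb: "- q (- x) \<le> q (x + t *\<^sub>R y) - t * q y" if "t \<ge> 0" for t x
    using sub(1)[of "x + t *\<^sub>R y" "- x"] sub(2)[OF that, of y] by simp
  have bdd: "bdd_below ((\<lambda>t. q (x + t *\<^sub>R y) - t * q y) ` {0..})" for x
    using lb by (intro bdd_belowI2) auto
  have up: "r x \<le> q (x + t *\<^sub>R y) - t * q y" if "t \<ge> 0" for t x
    unfolding r_def using that by (intro cINF_lower bdd) auto
  show "r x \<le> q x" "r x \<le> q (x + y) - q y"
    using up[of 0 x] up[of 1 x] by auto
  have glb: "z \<le> r x" if "\<And>t. t \<ge> 0 \<Longrightarrow> z \<le> q (x + t *\<^sub>R y) - t * q y" for x z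
    unfolding r_def using that by (intro cINF_greatest) auto
  show "sublinear r"
  proof (rule sublinearI)
    show "r (x + z) \<le> r x + r z" for x z
    proof -
      have "r (x + z) - (q (x + t *\<^sub>R y) - t * q y) \<le> q (z + s *\<^sub>R y) - s * q y"
        if "t \<ge> 0" "s \<ge> 0" for s t
        using up[of "t + s" "x + z"] that sub(1)[of "x + t *\<^sub>R y" "z + s *\<^sub>R y"]
        by (simp add: algebra_simps)
      then have "r (x + z) - (q (x + t *\<^sub>R y) - t * q y) \<le> r z" if "t \<ge> 0" for t
        using glb that by blast
      then have "r (x + z) - r z \<le> r x"
        by (intro glb) (simp add: algebra_simps)
      then show ?thesis
        by simp
    qed
    show "r (c *\<^sub>R x) \<le> c * r x" if c: "c > 0" for c x
    proof -
      have "r (c *\<^sub>R x) / c \<le> q (x + t *\<^sub>R y) - t * q y" if "t \<ge> 0" for t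
        using up[of "c * t" "c *\<^sub>R x"] sub(2)[of c "x + t *\<^sub>R y"] c that
        by (simp add: field_simps scaleR_add_right)
      then have "r (c *\<^sub>R x) / c \<le> r x"
        by (rule glb)
      then show ?thesis
        using c by (simp add: field_simps)
    qed
    have "r 0 \<le> 0" "0 \<le> r 0"
      using up[of 0 0] glb[of 0 0] sub(2)[of _ y] sub(3) by auto
    then show "r 0 = 0"
      by simp
  qed
qed

text \<open>Minimality makes the shifted functional coincide with \<open>q\<close>, which upgrades
  subadditivity to additivity; negative scalars then follow by additivity.\<close>

lemma minimal_sublinear_linear:
  assumes q: "sublinear q" and min: "\<And>r. sublinear r \<Longrightarrow> (\<And>x. r x \<le> q x) \<Longrightarrow> r = q"
  shows "linear q"
proof -
  note sub = sublinearD[OF q]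
  have add: "q (x + y) = q x + q y" for x y
  proof -
    define r where "r = (\<lambda>x. INF t\<in>{0..}. q (x + t *\<^sub>R y) - t * q y)"
    have "r = q"
      unfolding r_def by (intro min sublinear_shift[OF q])
    then have "q x \<le> q (x + y) - q y"
      using sublinear_shift(3)[OF q, where y = y and x = x] using fun_cong[OF \<open>r = q\<close>, of x] unfolding r_def by simp
    with sub(1)[of x y] show ?thesis
      by simp
  qed
  have "q (c *\<^sub>R x) = c * q x" for c x
  proof (cases "c \<ge> 0")
    case False
    then have "q ((- c) *\<^sub>R x) = - c * q x"
      using sub(2)[of "- c" x] by simp
    then show ?thesis
      using add[of "c *\<^sub>R x" "(- c) *\<^sub>R x"] sub(3) by simp
  qed (rule sub(2))
  with add show ?thesis
    by (intro linearI) auto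
qed

text \<open>Zorn's lemma is applied to the sublinear functionals below \<open>q\<close>, ordered
  downwards, rather than to partial extensions. No values of \<open>l\<close> are prescribed: in the
  application below, all requirements are encoded in \<open>q\<close>.\<close>

lemma hahn_banach_sublinear:
  assumes "sublinear (q :: 'a::real_vector \<Rightarrow> real)"
  obtains l where "linear l" "\<And>x. l x \<le> q x"
proof -
  define A where "A = {r :: 'a \<Rightarrow> real. sublinear r \<and> r \<le> q}"
  have "\<exists>m\<in>A. \<forall>a\<in>A. a \<le> m \<longrightarrow> a = m"
  proof (rule predicate_Zorn)
    show "partial_order_on A (relation_of (\<lambda>a b. b \<le> a) A)"
      by (rule partial_order_on_relation_ofI) auto
    fix C
    assume "C \<in> Chains (relation_of (\<lambda>a b. b \<le> a) A)"
    then have C: "C \<subseteq> A" "\<And>a b. a \<in> C \<Longrightarrow> b \<in> C \<Longrightarrow> a \<le> b \<or> b \<le> a"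
      by (auto simp: Chains_def relation_of_def)
    show "\<exists>u\<in>A. \<forall>a\<in>C. u \<le> a"
    proof (cases "C = {}")
      case True
      then show ?thesis
        using assms by (auto simp: A_def)
    next
      case False
      define r where "r x = (INF c\<in>C. c x)" for x
      \<comment> \<open>This bound, common to all members of the chain, keeps their pointwise
        infimum finite.\<close>
      have lb: "- q (- x) \<le> c x" if "c \<in> C" for c x
      proof -
        have "c (- x) \<le> q (- x)"
          using that C(1) by (auto simp: A_def le_fun_def)
        moreover have "- c (- x) \<le> c x"
          using that C(1) sublinearD(4)[of c x] by (auto simp: A_def)
        ultimately show ?thesis
          by simp
      qed
      have up: "r x \<le> c x" if "c \<in> C" for c x
        unfolding r_def using that lb by (intro cINF_lower bdd_belowI2[where m = "- q (- x)"]) auto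
      have glb: "z \<le> r x" if "\<And>c. c \<in> C \<Longrightarrow> z \<le> c x" for x z
        unfolding r_def using that False by (intro cINF_greatest) auto
      have sl: "sublinear c" if "c \<in> C" for c
        using that C(1) by (auto simp: A_def)
      have "sublinear r"
      proof (rule sublinearI)
        show "r (x + y) \<le> r x + r y" for x y
        proof -
          have "r (x + y) \<le> c x + d y" if cd: "c \<in> C" "d \<in> C" for c d
          proof -
            \<comment> \<open>In a chain the smaller of \<open>c\<close> and \<open>d\<close> lies
              below both, so its subadditivity serves for the mixed sum.\<close>
            obtain e where e: "e \<in> C" "e \<le> c" "e \<le> d"
              using C(2)[OF cd] cd by (metis order_refl)
            then have "e (x + y) \<le> c x + d y"
              using sublinearD(1)[OF sl[OF e(1)], of x y] by (smt (verit) le_fun_def)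
            then show ?thesis
              using up[OF e(1), of "x + y"] by simp
          qed
          note sum_le = this
          have "r (x + y) - c x \<le> r y" if "c \<in> C" for c
          proof (rule glb)
            show "r (x + y) - c x \<le> d y" if "d \<in> C" for d
              using sum_le[OF \<open>c \<in> C\<close> that] by simp
          qed
          then have "r (x + y) - r y \<le> r x"
            by (intro glb) (simp add: algebra_simps)
          then show ?thesis
            by simp
        qed
        show "r (c *\<^sub>R x) \<le> c * r x" if c: "c > 0" for c x
        proof -
          have "r (c *\<^sub>R x) / c \<le> d x" if "d \<in> C" for d
            using up[OF that, of "c *\<^sub>R x"] sublinearD(2)[OF sl[OF that], of c x] c
            by (simp add: field_simps)
          then have "r (c *\<^sub>R x) / c \<le> r x"
            by (rule glb)
          then show ?thesis
            using c by (simp add: field_simps)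
        qed
        obtain c where "c \<in> C"
          using False by blast
        then have "r 0 \<le> 0"
          using up[OF \<open>c \<in> C\<close>, of 0] sublinearD(3)[OF sl[OF \<open>c \<in> C\<close>]] by simp
        moreover have "0 \<le> r 0"
          by (intro glb) (simp add: sublinearD(3)[OF sl])
        ultimately show "r 0 = 0"
          by simp
      qed
      moreover have "r \<le> q"
        using False up C(1) unfolding A_def le_fun_def by (blast intro: order_trans)
      ultimately show ?thesis
        using up by (auto simp: A_def le_fun_def)
    qed
  qed
  then obtain m where m: "sublinear m" "m \<le> q" "\<And>a. sublinear a \<Longrightarrow> a \<le> q \<Longrightarrow> a \<le> m \<Longrightarrow> a = m"
    unfolding A_def by blast
  have "linear m"
    using m(1,3) minimal_sublinear_linear[OF m(1)] by (meson le_funI m(2) order_trans)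
  with m(2) that show ?thesis
    by (auto simp: le_fun_def)
qed

text \<open>With \<open>r\<close> a lower bound for the distance from \<open>x\<close> to
  \<open>C\<close>, the functional \<open>s\<close> encodes separation: a linear \<open>l\<close>
  below \<open>s\<close> is bounded by the norm (take t = 0) and satisfies l (x - y) \<le> -r (take
  h = x - y and t = 1).\<close>

lemma separation_point_closed_convex:
  fixes C :: "'a::real_normed_vector set"
  assumes C: "closed C" "convex C" and x: "x \<notin> C"
  obtains \<xi> :: "'a \<Rightarrow>\<^sub>L real" and r :: real
  where "r > 0" "\<And>y. y \<in> C \<Longrightarrow> blinfun_apply \<xi> y \<ge> blinfun_apply \<xi> x + r"
proof (cases "C = {}")
  case True
  then show ?thesis
    using that[of 1 0] by simp
next
  case False
  obtain r where r: "r > 0" "\<And>y. y \<in> C \<Longrightarrow> r \<le> norm (y - x)"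
  proof -
    obtain r where "r > 0" "ball x r \<subseteq> - C"
      using C(1) x open_contains_ball[of "- C"] by (auto simp: open_Compl)
    then show ?thesis
      using that[of r] by (force simp: subset_iff dist_norm norm_minus_commute not_less[symmetric])
  qed
  define T where "T = {0::real..} \<times> C"
  define s where "s h = (INF (t, y)\<in>T. norm (h + t *\<^sub>R (y - x)) - t * r)" for h
  \<comment> \<open>The distance bound offsets the term -t r, so the infimum is finite.\<close>
  have lb: "- norm h \<le> norm (h + t *\<^sub>R (y - x)) - t * r" if "t \<ge> 0" "y \<in> C" for h t y
  proof -
    have "t * r \<le> norm (t *\<^sub>R (y - x))"
      using r(2)[OF that(2)] that(1) by (simp add: mult_left_mono)
    also have "\<dots> \<le> norm (h + t *\<^sub>R (y - x)) + norm h"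
      by (metis add_diff_cancel_left' norm_triangle_ineq4)
    finally show ?thesis
      by simp
  qed
  have up: "s h \<le> norm (h + t *\<^sub>R (y - x)) - t * r" if "t \<ge> 0" "y \<in> C" for h t y
  proof -
    have "bdd_below ((\<lambda>(t, y). norm (h + t *\<^sub>R (y - x)) - t * r) ` T)"
      using lb by (intro bdd_belowI2[where m = "- norm h"]) (auto simp: T_def)
    then have "s h \<le> (\<lambda>(t, y). norm (h + t *\<^sub>R (y - x)) - t * r) (t, y)"
      unfolding s_def using that by (intro cINF_lower) (auto simp: T_def)
    then show ?thesis
      by simp
  qed
  have glb: "z \<le> s h" if "\<And>t y. t \<ge> 0 \<Longrightarrow> y \<in> C \<Longrightarrow> z \<le> norm (h + t *\<^sub>R (y - x)) - t * r" for z h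
    unfolding s_def using that False by (intro cINF_greatest) (auto simp: T_def)
  have s_norm: "s h \<le> norm h" for h
    using up[of 0 _ h] False by auto
  have "sublinear s"
  proof (rule sublinearI)
    show "s (g + h) \<le> s g + s h" for g h
    proof -
      have "s (g + h) \<le> (norm (g + t *\<^sub>R (y - x)) - t * r) + (norm (h + u *\<^sub>R (z - x)) - u * r)"
        if tu: "t \<ge> 0" "u \<ge> 0" and yz: "y \<in> C" "z \<in> C" for t u y z
      proof (cases "t + u = 0")
        case True
        then show ?thesis
          using tu s_norm[of "g + h"] norm_triangle_ineq[of g h] order_trans by (force simp: add_nonneg_eq_0_iff)
      next
        case False
        then have pos: "t + u > 0"
          using tu by simp
        \<comment> \<open>Convexity of \<open>C\<close> merges the two displacements into a single
          one of weight t + u; weight zero cannot be normalized and was treated apart.\<close>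
        define w where "w = (t / (t + u)) *\<^sub>R y + (u / (t + u)) *\<^sub>R z"
        have "w \<in> C"
          unfolding w_def using C(2) yz tu pos
          by (intro convexD) (auto simp: add_divide_distrib[symmetric])
        moreover have "(t + u) *\<^sub>R (w - x) = t *\<^sub>R (y - x) + u *\<^sub>R (z - x)"
          using pos by (simp add: w_def scaleR_add_right scaleR_diff_right scaleR_add_left)
        ultimately have "s (g + h) \<le> norm ((g + t *\<^sub>R (y - x)) + (h + u *\<^sub>R (z - x))) - (t + u) * r"
          using up[of "t + u" w "g + h"] tu by (simp add: algebra_simps)
        also have "\<dots> \<le> norm (g + t *\<^sub>R (y - x)) + norm (h + u *\<^sub>R (z - x)) - (t + u) * r"
          by (intro diff_right_mono norm_triangle_ineq)
        finally show ?thesis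
          by (simp add: algebra_simps)
      qed
      note sum_le = this
      have "s (g + h) - (norm (g + t *\<^sub>R (y - x)) - t * r) \<le> s h" if "t \<ge> 0" "y \<in> C" for t y
        by (rule glb) (simp add: diff_le_eq add.commute[of _ "norm (g + _) - _"] sum_le that)
      then have "s (g + h) - s h \<le> s g"
        by (intro glb) (fastforce simp: algebra_simps)
      then show ?thesis
        by simp
    qed
    show "s (c *\<^sub>R h) \<le> c * s h" if c: "c > 0" for c h
    proof -
      have "s (c *\<^sub>R h) / c \<le> norm (h + t *\<^sub>R (y - x)) - t * r" if "t \<ge> 0" "y \<in> C" for t y
      proof -
        have "norm (c *\<^sub>R h + (c * t) *\<^sub>R (y - x)) = c * norm (h + t *\<^sub>R (y - x))"
          using c norm_scaleR[of c "h + t *\<^sub>R (y - x)"] by (simp add: scaleR_add_right)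
        then show ?thesis
          using up[of "c * t" y "c *\<^sub>R h"] c that by (simp add: field_simps)
      qed
      then have "s (c *\<^sub>R h) / c \<le> s h"
        by (rule glb)
      then show ?thesis
        using c by (simp add: field_simps)
    qed
    have "0 \<le> s 0"
      by (rule glb) (use lb[of _ _ 0] in simp)
    then show "s 0 = 0"
      using s_norm[of 0] by simp
  qed
  then obtain l where l: "linear l" "\<And>h. l h \<le> s h"
    using hahn_banach_sublinear by blast
  have ln: "\<bar>l h\<bar> \<le> norm h" for h
  proof -
    have "l h \<le> norm h" "l (- h) \<le> norm h"
      using l(2)[of h] s_norm[of h] l(2)[of "- h"] s_norm[of "- h"] by auto
    then show ?thesis
      using linear_neg[OF l(1), of h] by auto
  qed
  have bl: "bounded_linear l"
    using l(1) ln by (intro bounded_linear_intro[where K = 1]) (auto simp: linear_add linear_cmul)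
  have "l y \<ge> l x + r" if "y \<in> C" for y
  proof -
    have "l (- (y - x)) \<le> - r"
      using l(2)[of "- (y - x)"] up[of 1 y "- (y - x)"] that by simp
    then show ?thesis
      using linear_diff[OF l(1), of x y] by simp
  qed
  then show ?thesis
    using that[of r "Blinfun l"] r(1) bl by (simp add: bounded_linear_Blinfun_apply)
qed

lemma weakly_closed_convex:
  fixes C :: "'a::real_normed_vector set"
  assumes "closed C" "convex C" "G \<noteq> bot" "eventually (\<lambda>i. v i \<in> C) G"
    and lim: "\<And>\<xi> :: 'a \<Rightarrow>\<^sub>L real. ((\<lambda>i. blinfun_apply \<xi> (v i)) \<longlongrightarrow> blinfun_apply \<xi> w) G"
  shows "w \<in> C"
proof (rule ccontr)
  assume "w \<notin> C"
  then obtain \<xi> :: "'a \<Rightarrow>\<^sub>L real" and r where r: "r > 0"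
      "\<And>y. y \<in> C \<Longrightarrow> blinfun_apply \<xi> y \<ge> blinfun_apply \<xi> w + r"
    by (rule separation_point_closed_convex[OF assms(1,2)]) (rule that)
  have "eventually (\<lambda>i. blinfun_apply \<xi> w + r \<le> blinfun_apply \<xi> (v i)) G"
    using assms(4) by eventually_elim (use r in auto)
  then have "blinfun_apply \<xi> w + r \<le> blinfun_apply \<xi> w"
    using tendsto_lowerbound[OF lim] assms(3) by blast
  with r(1) show False
    by simp
qed

text \<open>The dual norm is a supremum of evaluations, hence weak* lower semicontinuous;
  \<open>le\<close> provides the opposite bound.\<close>

lemma weak_star_norm_tendsto:
  fixes \<xi> :: "'i \<Rightarrow> ('a::real_normed_vector \<Rightarrow>\<^sub>L real)"
  assumes lim: "\<And>x. ((\<lambda>i. blinfun_apply (\<xi> i) x) \<longlongrightarrow> blinfun_apply \<zeta> x) F"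
    and le: "eventually (\<lambda>i. norm (\<xi> i) \<le> norm \<zeta>) F"
  shows "((\<lambda>i. norm (\<xi> i)) \<longlongrightarrow> norm \<zeta>) F"
proof (rule order_tendstoI)
  fix c
  assume c: "c < norm \<zeta>"
  show "eventually (\<lambda>i. c < norm (\<xi> i)) F"
  proof (cases "c < 0")
    case True
    then show ?thesis
      by (intro always_eventually) (use norm_ge_zero less_le_trans in blast)
  next
    case False
    then obtain x where x: "c * norm x < norm (blinfun_apply \<zeta> x)"
      using c norm_blinfun_bound[of c \<zeta>] by (meson not_le)
    have "eventually (\<lambda>i. c * norm x < norm (blinfun_apply (\<xi> i) x)) F"
      using order_tendstoD(1)[OF tendsto_norm[OF lim] x] .
    then show ?thesis
    proof eventually_elim
      case (elim i)
      then have "c * norm x < norm (\<xi> i) * norm x"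
        using norm_blinfun[of "\<xi> i" x] by simp
      then show ?case
        using mult_less_cancel_right_pos[of "norm x"] by (cases "x = 0") auto
    qed
  qed
next
  fix c
  assume "norm \<zeta> < c"
  then show "eventually (\<lambda>i. norm (\<xi> i) < c) F"
    using le by (auto elim!: eventually_mono)
qed

text \<open>After normalization, pick a point \<open>x\<close> at which \<open>z\<close> nearly
  attains its norm. Weak* convergence makes the midpoint of \<open>y i\<close> and \<open>z\<close>
  large at \<open>x\<close>, and uniform convexity then forces \<open>y i\<close> close to
  \<open>z\<close>. Evaluations at points of the space suffice for this.\<close>

lemma radon_riesz_weak_star:
  fixes \<xi> :: "'i \<Rightarrow> ('a::real_normed_vector \<Rightarrow>\<^sub>L real)"
  assumes uc: "uniformly_convex_space TYPE('a \<Rightarrow>\<^sub>L real)"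
    and lim: "\<And>x. ((\<lambda>i. blinfun_apply (\<xi> i) x) \<longlongrightarrow> blinfun_apply \<zeta> x) F"
    and nlim: "((\<lambda>i. norm (\<xi> i)) \<longlongrightarrow> norm \<zeta>) F"
  shows "(\<xi> \<longlongrightarrow> \<zeta>) F"
proof (cases "\<zeta> = 0")
  case True
  then show ?thesis
    using nlim by (simp add: tendsto_norm_zero_iff)
next
  case False
  define z where "z = \<zeta> /\<^sub>R norm \<zeta>"
  define y where "y i = \<xi> i /\<^sub>R norm (\<xi> i)" for i
  have nz: "norm z = 1"
    using False by (simp add: z_def)
  have ev: "eventually (\<lambda>i. norm (\<xi> i) > 0) F"
    using order_tendstoD(1)[OF nlim, of 0] False by simp
  have ylim: "((\<lambda>i. blinfun_apply (y i) x) \<longlongrightarrow> blinfun_apply z x) F" for x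
    unfolding y_def z_def blinfun.scaleR_left
    by (intro tendsto_intros lim nlim) (use False in simp)
  have "(y \<longlongrightarrow> z) F"
  proof (rule tendstoI)
    fix e :: real
    assume "e > 0"
    \<comment> \<open>The modulus of convexity is only defined up to 2.\<close>
    define \<eta> where "\<eta> = min e 2"
    obtain d where d: "d > 0" "\<And>x y :: 'a \<Rightarrow>\<^sub>L real. norm x = 1 \<Longrightarrow> norm y = 1 \<Longrightarrow> norm (x - y) \<ge> \<eta> \<Longrightarrow>
        norm ((x + y) /\<^sub>R 2) \<le> 1 - d"
      using uc \<open>e > 0\<close> unfolding uniformly_convex_space_def \<eta>_def
      by (metis min.cobounded2 min_less_iff_conj zero_less_numeral)
    obtain x where x: "norm (blinfun_apply z x) > (1 - d) * norm x"
    proof (rule ccontr)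
      assume "\<not> thesis"
      with that have *: "norm (blinfun_apply z x) \<le> (1 - d) * norm x" for x
        by (meson not_le)
      \<comment> \<open>The maximum guards against d > 1, where 1 - d is not an admissible norm
        bound.\<close>
      have "norm z \<le> max 0 (1 - d)"
        using order_trans[OF * mult_right_mono[OF max.cobounded2 norm_ge_zero]]
        by (intro norm_blinfun_bound) simp_all
      with nz d(1) show False
        by auto
    qed
    have "((\<lambda>i. norm (blinfun_apply ((y i + z) /\<^sub>R 2) x)) \<longlongrightarrow> norm (blinfun_apply ((z + z) /\<^sub>R 2) x)) F"
      unfolding blinfun.scaleR_left blinfun.add_left by (intro tendsto_intros ylim)
    then have "((\<lambda>i. norm (blinfun_apply ((y i + z) /\<^sub>R 2) x)) \<longlongrightarrow> norm (blinfun_apply z x)) F"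
      by (simp add: scaleR_2[symmetric])
    then have "eventually (\<lambda>i. norm (blinfun_apply ((y i + z) /\<^sub>R 2) x) > (1 - d) * norm x) F"
      using x by (rule order_tendstoD)
    with ev show "eventually (\<lambda>i. dist (y i) z < e) F"
    proof eventually_elim
      case (elim i)
      have "norm (y i) = 1"
        using elim(1) by (simp add: y_def)
      moreover have "norm ((y i + z) /\<^sub>R 2) > 1 - d"
        using norm_blinfun[of "(y i + z) /\<^sub>R 2" x] elim(2)
        by (smt (verit, best) mult_right_mono norm_ge_zero)
      ultimately have "norm (y i - z) < \<eta>"
        using d(2)[of "y i" z] nz by (meson not_le)
      then show ?case
        by (simp add: \<eta>_def dist_norm)
    qed
  qed
  then have "((\<lambda>i. norm (\<xi> i) *\<^sub>R y i) \<longlongrightarrow> norm \<zeta> *\<^sub>R z) F"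
    by (intro tendsto_intros nlim)
  then have "((\<lambda>i. norm (\<xi> i) *\<^sub>R y i) \<longlongrightarrow> \<zeta>) F"
    using False by (simp add: z_def)
  then show ?thesis
    by (rule Lim_transform_eventually) (use ev in \<open>auto elim!: eventually_mono simp: y_def\<close>)
qed

text \<open>A norm bound makes the pairing of weak* convergent functionals with norm convergent
  points continuous.\<close>

lemma weak_star_tendsto_apply:
  fixes \<xi> :: "'i \<Rightarrow> ('a::real_normed_vector \<Rightarrow>\<^sub>L real)"
  assumes bd: "eventually (\<lambda>i. norm (\<xi> i) \<le> M) F"
    and lim: "((\<lambda>i. blinfun_apply (\<xi> i) v) \<longlongrightarrow> blinfun_apply \<zeta> v) F"
    and w: "(w \<longlongrightarrow> v) F"
  shows "((\<lambda>i. blinfun_apply (\<xi> i) (w i)) \<longlongrightarrow> blinfun_apply \<zeta> v) F"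
proof -
  have "((\<lambda>i. M * norm (w i - v)) \<longlongrightarrow> M * norm (v - v)) F"
    by (intro tendsto_intros w)
  then have "((\<lambda>i. M * norm (w i - v)) \<longlongrightarrow> 0) F"
    by simp
  moreover have "eventually (\<lambda>i. norm (blinfun_apply (\<xi> i) (w i - v)) \<le> M * norm (w i - v)) F"
    using bd
  proof eventually_elim
    case (elim i)
    then show ?case
      using norm_blinfun[of "\<xi> i" "w i - v"] mult_right_mono[OF elim, of "norm (w i - v)"] by simp
  qed
  ultimately have "((\<lambda>i. blinfun_apply (\<xi> i) (w i - v)) \<longlongrightarrow> 0) F"
    by (rule Lim_null_comparison[rotated])
  from tendsto_add[OF this lim] show ?thesis
    by (simp add: blinfun.diff_right)
qed

subsection \<open>The duality map\<close>

lemma real_subdifferential_iff: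
  "\<xi> \<in> subdifferential (\<lambda>u. ereal (g u)) u \<longleftrightarrow> (\<forall>w. g u + blinfun_apply \<xi> (w - u) \<le> g w)"
  by (auto simp: subdifferential_def eff_dom_def blinfun.diff_right algebra_simps)

text \<open>The difference quotient is squeezed between the pairings at \<open>u\<close> and at the
  shifted point, so a subgradient selection that is continuous along the line is the derivative. It
  serves both the power of the norm and the envelope.\<close>

lemma subgradient_selection_derivative:
  fixes A :: "'a::real_normed_vector \<Rightarrow> ('a \<Rightarrow>\<^sub>L real)"
  assumes sub: "\<And>u w. g u + blinfun_apply (A u) (w - u) \<le> g w"
    and lim: "((\<lambda>t. blinfun_apply (A (u + t *\<^sub>R h)) h) \<longlongrightarrow> blinfun_apply (A u) h) (at 0)"
  shows "((\<lambda>t. g (u + t *\<^sub>R h)) has_real_derivative blinfun_apply (A u) h) (at 0)"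
proof -
  define a where "a t = blinfun_apply (A (u + t *\<^sub>R h)) h" for t :: real
  define d where "d t = (g (u + t *\<^sub>R h) - g u) / t" for t :: real
  have "norm (d t - a 0) \<le> \<bar>a t - a 0\<bar>" if "t \<noteq> 0" for t
  proof -
    \<comment> \<open>Both bounds carry the factor t, so that the sign of t is split only
      once.\<close>
    have "t * a 0 \<le> t * d t" "t * d t \<le> t * a t"
      using sub[of u "u + t *\<^sub>R h"] sub[of "u + t *\<^sub>R h" u] that
      by (auto simp: a_def d_def blinfun.scaleR_right blinfun.minus_right)
    then show ?thesis
      using that by (cases "t > 0") auto
  qed
  then have "eventually (\<lambda>t. norm (d t - a 0) \<le> \<bar>a t - a 0\<bar>) (at 0)"
    by (auto simp: eventually_at_filter)
  moreover have "((\<lambda>t. \<bar>a t - a 0\<bar>) \<longlongrightarrow> 0) (at 0)"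
    using lim by (simp add: a_def tendsto_rabs_zero_iff LIM_zero_iff)
  ultimately have "((\<lambda>t. d t - a 0) \<longlongrightarrow> 0) (at 0)"
    by (rule Lim_null_comparison)
  then show ?thesis
    by (simp add: DERIV_def d_def a_def LIM_zero_iff)
qed

section \<open>Strict convexity of powers of the norm\<close>

lemma powr_split:
  fixes x p :: real
  assumes "x \<ge> 0"
  shows "x powr p = x powr (p - 1) * x"
  using assms by (cases "x = 0") (auto simp: powr_diff)

text \<open>Mean value theorem and strict growth of z^(p-1). A zero endpoint is done by hand, since
  the derivative rule for \<open>powr\<close> is applied at positive bases.\<close>

lemma powr_tangent_strict:
  fixes x y p :: real
  assumes "p > 1" "x \<ge> 0" "y \<ge> 0" "x \<noteq> y"
  shows "y powr (p - 1) * (x - y) < x powr p / p - y powr p / p"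
proof -
  consider "x = 0" "y > 0" | "y = 0" "x > 0" | "x > 0" "y > 0" "x < y" | "x > 0" "y > 0" "y < x"
    using assms by linarith
  then show ?thesis
  proof cases
    case 1
    have "y powr p / p < y powr p"
      using assms(1) 1 by (simp add: field_simps)
    then show ?thesis
      using 1 powr_split[of y p] by simp
  next
    case 2
    then show ?thesis
      using assms(1) by simp
  next
    case 3
    have "\<exists>z. x < z \<and> z < y \<and> y powr p / p - x powr p / p = (y - x) * z powr (p - 1)"
      using 3 assms(1) by (intro MVT2) (auto intro!: derivative_eq_intros simp: field_simps)
    then obtain z where z: "x < z" "z < y" "y powr p / p - x powr p / p = (y - x) * z powr (p - 1)"
      by blast
    have "(y - x) * z powr (p - 1) < (y - x) * y powr (p - 1)"
      using z(1,2) 3 assms(1) by (intro mult_strict_left_mono powr_less_mono2) auto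
    then show ?thesis
      using z(3) by (simp add: algebra_simps)
  next
    case 4
    have "\<exists>z. y < z \<and> z < x \<and> x powr p / p - y powr p / p = (x - y) * z powr (p - 1)"
      using 4 assms(1) by (intro MVT2) (auto intro!: derivative_eq_intros simp: field_simps)
    then obtain z where z: "y < z" "z < x" "x powr p / p - y powr p / p = (x - y) * z powr (p - 1)"
      by blast
    have "(x - y) * y powr (p - 1) < (x - y) * z powr (p - 1)"
      using z(1,2) 4 assms(1) by (intro mult_strict_left_mono powr_less_mono2) auto
    then show ?thesis
      using z(3) by (simp add: algebra_simps)
  qed
qed

lemma powr_tangent:
  fixes x y p :: real
  assumes "p > 1" "x \<ge> 0" "y \<ge> 0"
  shows "y powr (p - 1) * (x - y) \<le> x powr p / p - y powr p / p"
  using powr_tangent_strict[OF assms] by (cases "x = y") auto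

text \<open>The tangent inequalities at the mean \<open>m\<close>, weighted by t and 1 - t, add up
  with cancelling linear terms; the one at \<open>x\<close> is strict.\<close>

lemma powr_strictly_convex:
  fixes x y p t :: real
  assumes p: "p > 1" and xy: "x \<ge> 0" "y \<ge> 0" "x \<noteq> y" and t: "0 < t" "t < 1"
  shows "(t * x + (1 - t) * y) powr p < t * x powr p + (1 - t) * y powr p"
proof -
  define m where "m = t * x + (1 - t) * y"
  have m: "m \<ge> 0" "x - m = (1 - t) * (x - y)" "y - m = - t * (x - y)"
    using xy t by (simp add: m_def) (simp_all add: m_def algebra_simps)
  then have ne: "x \<noteq> m"
    using xy(3) t by auto
  have "t * (m powr (p - 1) * (x - m)) < t * (x powr p / p - m powr p / p)"
    using powr_tangent_strict[OF p xy(1) m(1) ne] t by simp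
  moreover have "(1 - t) * (m powr (p - 1) * (y - m)) \<le> (1 - t) * (y powr p / p - m powr p / p)"
    using powr_tangent[OF p xy(2) m(1)] t by (intro mult_left_mono) auto
  ultimately have "0 < (t * x powr p + (1 - t) * y powr p - m powr p) / p"
    unfolding m(2,3) by (simp add: algebra_simps diff_divide_distrib add_divide_distrib)
  then show ?thesis
    using p by (simp add: zero_less_divide_iff m_def)
qed

text \<open>Strictness has two sources: the unit sphere if the norms of \<open>x\<close> and
  \<open>y\<close> agree, the real power if they differ.\<close>

lemma norm_powr_strictly_convex:
  fixes x y :: "'a::real_normed_vector" and p t :: real
  assumes sc: "strictly_convex_space TYPE('a)" and p: "p > 1" and ne: "x \<noteq> y" and t: "0 < t" "t < 1"
  shows "norm (t *\<^sub>R x + (1 - t) *\<^sub>R y) powr p < t * norm x powr p + (1 - t) * norm y powr p"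
proof (cases "norm x = norm y")
  case True
  define a where "a = norm x"
  have a: "a > 0"
    using True ne by (auto simp: a_def)
  have n: "norm (x /\<^sub>R a) = 1" "norm (y /\<^sub>R a) = 1" "x /\<^sub>R a \<noteq> y /\<^sub>R a"
    using a True ne by (auto simp: a_def)
  have "norm (t *\<^sub>R (x /\<^sub>R a) + (1 - t) *\<^sub>R (y /\<^sub>R a)) < 1"
    using sc n t unfolding strictly_convex_space_def by (meson greaterThanLessThan_iff)
  moreover have "t *\<^sub>R (x /\<^sub>R a) + (1 - t) *\<^sub>R (y /\<^sub>R a) = (t *\<^sub>R x + (1 - t) *\<^sub>R y) /\<^sub>R a"
    by (simp add: scaleR_add_right mult.commute)
  ultimately have "norm ((t *\<^sub>R x + (1 - t) *\<^sub>R y) /\<^sub>R a) < 1"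
    by (simp only:)
  then have "norm (t *\<^sub>R x + (1 - t) *\<^sub>R y) < a"
    using a by (simp add: pos_divide_less_eq divide_inverse_commute[symmetric])
  then have "norm (t *\<^sub>R x + (1 - t) *\<^sub>R y) powr p < a powr p"
    using p by (intro powr_less_mono2) auto
  also have "\<dots> = t * norm x powr p + (1 - t) * norm y powr p"
    using True by (simp add: a_def algebra_simps)
  finally show ?thesis .
next
  case False
  have "norm (t *\<^sub>R x + (1 - t) *\<^sub>R y) \<le> t * norm x + (1 - t) * norm y"
    using norm_triangle_ineq[of "t *\<^sub>R x" "(1 - t) *\<^sub>R y"] t by simp
  then have "norm (t *\<^sub>R x + (1 - t) *\<^sub>R y) powr p \<le> (t * norm x + (1 - t) * norm y) powr p"
    using p by (intro powr_mono2) auto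
  also have "\<dots> < t * norm x powr p + (1 - t) * norm y powr p"
    using powr_strictly_convex[OF p _ _ False t] by simp
  finally show ?thesis .
qed

text \<open>One direction is the tangent inequality for the power; the other tests the subgradient
  inequality near \<open>v\<close>. The norm condition is the usual one on the conjugate power of
  the dual norm, rewritten with exponent p - 1.\<close>

lemma p_duality_map_iff:
  fixes v :: "'a::real_normed_vector"
  assumes p: "p > 1"
  shows "\<eta> \<in> p_duality_map p v \<longleftrightarrow>
    blinfun_apply \<eta> v = norm v powr p \<and> norm \<eta> = norm v powr (p - 1)"
proof
  define a where "a = norm v"
  have a: "a \<ge> 0"
    by (simp add: a_def)
  have split: "a powr p = a powr (p - 1) * a"
    using a by (rule powr_split)
  assume \<eta>: "blinfun_apply \<eta> v = norm v powr p \<and> norm \<eta> = norm v powr (p - 1)"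
  have "1 / p * norm v powr p + blinfun_apply \<eta> (w - v) \<le> 1 / p * norm w powr p" for w
  proof -
    have "blinfun_apply \<eta> w \<le> a powr (p - 1) * norm w"
      using norm_blinfun[of \<eta> w] \<eta> by (simp add: a_def)
    moreover have "a powr (p - 1) * (norm w - a) \<le> norm w powr p / p - a powr p / p"
      using powr_tangent[OF p, of "norm w" a] a by simp
    ultimately show ?thesis
      using \<eta> split unfolding a_def[symmetric] by (simp add: blinfun.diff_right algebra_simps)
  qed
  then show "\<eta> \<in> p_duality_map p v"
    by (simp add: p_duality_map_def real_subdifferential_iff)
next
  define a where "a = norm v"
  have a: "a \<ge> 0"
    by (simp add: a_def)
  have split: "a powr p = a powr (p - 1) * a"
    using a by (rule powr_split)
  assume "\<eta> \<in> p_duality_map p v"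
  then have sub: "1 / p * norm v powr p + blinfun_apply \<eta> (w - v) \<le> 1 / p * norm w powr p" for w
    by (simp add: p_duality_map_def real_subdifferential_iff)
  have at_right: "((\<lambda>t::real. t) \<longlongrightarrow> 0) (at_right 0)"
    by (rule tendsto_ident_at)
  \<comment> \<open>Testing at v + t h and letting t decrease to 0 bounds the slope in every
    direction, hence the dual norm.\<close>
  have up: "blinfun_apply \<eta> h \<le> a powr (p - 1) * norm h" for h
  proof -
    have le: "blinfun_apply \<eta> h \<le> (a + t * norm h) powr (p - 1) * norm h" if t: "t > 0" for t
    proof -
      have "t * blinfun_apply \<eta> h \<le> norm (v + t *\<^sub>R h) powr p / p - a powr p / p"
        using sub[of "v + t *\<^sub>R h"] by (simp add: blinfun.scaleR_right a_def)
      also have "norm (v + t *\<^sub>R h) powr p \<le> (a + t * norm h) powr p"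
        using p norm_triangle_ineq[of v "t *\<^sub>R h"] t by (intro powr_mono2) (auto simp: a_def)
      then have "norm (v + t *\<^sub>R h) powr p / p - a powr p / p \<le> (a + t * norm h) powr p / p - a powr p / p"
        using p by (simp add: divide_right_mono)
      also have "\<dots> \<le> (a + t * norm h) powr (p - 1) * (t * norm h)"
        using powr_tangent[OF p, of a "a + t * norm h"] a t by (simp add: algebra_simps)
      finally show ?thesis
        using t by simp
    qed
    have "((\<lambda>t. (a + t * norm h) powr (p - 1) * norm h) \<longlongrightarrow> (a + 0 * norm h) powr (p - 1) * norm h) (at_right 0)"
      using p a
      by (intro tendsto_mult tendsto_powr' tendsto_add tendsto_const at_right)
        (auto intro!: eventually_at_right_less[THEN eventually_mono])
    then have "blinfun_apply \<eta> h \<le> (a + 0 * norm h) powr (p - 1) * norm h"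
      by (rule tendsto_lowerbound) (auto intro!: eventually_at_right_less[THEN eventually_mono] le)
    then show ?thesis
      by simp
  qed
  have nle: "norm \<eta> \<le> a powr (p - 1)"
  proof (rule norm_blinfun_bound)
    show "norm (blinfun_apply \<eta> x) \<le> a powr (p - 1) * norm x" for x
      using up[of x] up[of "- x"] by (auto simp: blinfun.minus_right)
  qed simp
  \<comment> \<open>Shrinking \<open>v\<close> radially bounds the value at \<open>v\<close> from
    below; in the limit this meets the upper bound \<open>up\<close> with h = v.\<close>
  have ge: "(1 - t) powr (p - 1) * a powr p \<le> blinfun_apply \<eta> v" if t: "0 < t" "t < 1" for t
  proof -
    have "1 / p * a powr p - t * blinfun_apply \<eta> v \<le> 1 / p * norm ((1 - t) *\<^sub>R v) powr p"
      using sub[of "(1 - t) *\<^sub>R v"]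
      by (simp add: scaleR_diff_left blinfun.minus_right blinfun.scaleR_right a_def)
    also have "norm ((1 - t) *\<^sub>R v) = (1 - t) * a"
      using t by (simp add: a_def)
    finally have 1: "a powr p / p - ((1 - t) * a) powr p / p \<le> t * blinfun_apply \<eta> v"
      by simp
    have "((1 - t) * a) powr (p - 1) * (a - (1 - t) * a) \<le> a powr p / p - ((1 - t) * a) powr p / p"
      using powr_tangent[OF p, of a "(1 - t) * a"] a t by simp
    also note 1
    also have "((1 - t) * a) powr (p - 1) * (a - (1 - t) * a) = t * ((1 - t) powr (p - 1) * a powr p)"
    proof -
      have "((1 - t) * a) powr (p - 1) = (1 - t) powr (p - 1) * a powr (p - 1)"
        using t a by (simp add: powr_mult)
      then show ?thesis
        unfolding split by (simp add: algebra_simps)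
    qed
    finally show ?thesis
      using t by simp
  qed
  have "((\<lambda>t. (1 - t) powr (p - 1) * a powr p) \<longlongrightarrow> (1 - 0) powr (p - 1) * a powr p) (at_right 0)"
    by (intro tendsto_mult tendsto_powr' tendsto_diff tendsto_const at_right) auto
  then have "(1 - 0) powr (p - 1) * a powr p \<le> blinfun_apply \<eta> v"
  proof (rule tendsto_upperbound)
    show "eventually (\<lambda>t. (1 - t) powr (p - 1) * a powr p \<le> blinfun_apply \<eta> v) (at_right 0)"
      using eventually_at_right_real[of 0 "1::real"] by (auto elim!: eventually_mono intro: ge)
  qed simp
  then have val: "blinfun_apply \<eta> v = a powr p"
    using up[of v] split by (simp add: a_def)
  have "a powr (p - 1) \<le> norm \<eta>"
  proof (cases "a = 0")
    case False
    then have "a powr (p - 1) * a \<le> norm \<eta> * a"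
      using norm_blinfun[of \<eta> v] val split by (simp add: a_def)
    then show ?thesis
      using False a by (simp add: mult_le_cancel_right)
  qed (use p in simp)
  with nle val show "blinfun_apply \<eta> v = norm v powr p \<and> norm \<eta> = norm v powr (p - 1)"
    by (simp add: a_def)
qed

text \<open>Smoothness speaks of the map for p = 2. Multiplication by norm v^(p-2) carries that map
  to this one; at v = 0 this factor is no longer positive, and only the zero functional
  qualifies.\<close>

lemma p_duality_map_single_valued:
  fixes v :: "'a::real_normed_vector"
  assumes sm: "smooth_space TYPE('a)" and p: "p > 1"
  shows "\<exists>!\<eta>. \<eta> \<in> p_duality_map p v"
proof (cases "v = 0")
  case True
  have "\<eta> \<in> p_duality_map p v \<longleftrightarrow> \<eta> = 0" for \<eta>
    using p True by (auto simp: p_duality_map_iff)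
  then show ?thesis
    by simp
next
  case False
  define c where "c = norm v powr (p - 2)"
  have c: "c > 0" "c * norm v = norm v powr (p - 1)" "c * (norm v)\<^sup>2 = norm v powr p"
    using False by (simp_all add: c_def powr_diff power2_eq_square powr_numeral)
  have iff: "\<xi> \<in> duality_map v \<longleftrightarrow> c *\<^sub>R \<xi> \<in> p_duality_map p v" for \<xi>
    using c False p unfolding duality_map_def p_duality_map_iff[OF p]
    by (auto simp: blinfun.scaleR_left c(2,3)[symmetric])
  obtain \<xi> where \<xi>: "\<xi> \<in> duality_map v" "\<And>\<zeta>. \<zeta> \<in> duality_map v \<Longrightarrow> \<zeta> = \<xi>"
    using sm unfolding smooth_space_def by metis
  show ?thesis
  proof (rule ex1I)
    show "c *\<^sub>R \<xi> \<in> p_duality_map p v"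
      using \<xi>(1) iff by blast
    fix \<eta>
    assume "\<eta> \<in> p_duality_map p v"
    then have "\<eta> /\<^sub>R c \<in> duality_map v"
      using iff[of "\<eta> /\<^sub>R c"] c(1) by simp
    then show "\<eta> = c *\<^sub>R \<xi>"
      using \<xi>(2)[of "\<eta> /\<^sub>R c"] c(1) by auto
  qed
qed

definition p_dual :: "real \<Rightarrow> 'a::real_normed_vector \<Rightarrow> ('a \<Rightarrow>\<^sub>L real)" where
  "p_dual p v = (THE \<eta>. \<eta> \<in> p_duality_map p v)"

context
  fixes p :: real
  assumes smooth: "smooth_space TYPE('a::real_normed_vector)" and p_gt_1: "p > 1"
begin

lemma p_duality_map_eq: "p_duality_map p (v :: 'a) = {p_dual p v}"
  using p_duality_map_single_valued[OF smooth p_gt_1, of v] unfolding p_dual_def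
  by (metis (mono_tags, lifting) singleton_iff subsetI subset_antisym theI')

lemma p_dual_apply_self: "blinfun_apply (p_dual p v) v = norm (v :: 'a) powr p"
  and norm_p_dual: "norm (p_dual p v) = norm v powr (p - 1)"
  using p_duality_map_iff[OF p_gt_1] p_duality_map_eq by blast+

lemma p_dual_eqI:
  assumes "\<And>w :: 'a. norm v powr p / p + blinfun_apply \<eta> (w - v) \<le> norm w powr p / p"
  shows "\<eta> = p_dual p v"
proof -
  have "\<eta> \<in> p_duality_map p v"
    using assms by (simp add: p_duality_map_def real_subdifferential_iff)
  then show ?thesis
    by (simp add: p_duality_map_eq)
qed

lemma p_dual_subgradient:
  "norm (v :: 'a) powr p / p + blinfun_apply (p_dual p v) (w - v) \<le> norm w powr p / p"
proof -
  have "p_dual p v \<in> p_duality_map p v"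
    by (simp add: p_duality_map_eq)
  then show ?thesis
    by (simp add: p_duality_map_def real_subdifferential_iff)
qed

lemma p_dual_minus: "p_dual p (- v :: 'a) = - p_dual p v"
proof -
  have "- p_dual p v \<in> p_duality_map p (- v)"
    using p_dual_apply_self[of v] norm_p_dual[of v]
    by (simp add: p_duality_map_iff[OF p_gt_1] blinfun.minus_left blinfun.minus_right)
  then show ?thesis
    by (simp add: p_duality_map_eq)
qed

text \<open>The subgradient inequality is preserved when \<open>v i\<close> converges in norm and
  the functionals weak*. Every cluster point is thus a subgradient at \<open>v0\<close>, and there
  is only one.\<close>

lemma p_dual_weak_star_continuous:
  assumes v: "(v \<longlongrightarrow> (v0 :: 'a)) F"
  shows "((\<lambda>i. blinfun_apply (p_dual p (v i)) x) \<longlongrightarrow> blinfun_apply (p_dual p v0) x) F"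
proof (rule weak_star_limit_unique_cluster)
  have "eventually (\<lambda>i. norm (v i) < norm v0 + 1) F"
    by (rule order_tendstoD(2)[OF tendsto_norm[OF v]]) simp
  then show bd: "eventually (\<lambda>i. norm (p_dual p (v i)) \<le> (norm v0 + 1) powr (p - 1)) F"
    by eventually_elim (use p_gt_1 in \<open>auto simp: norm_p_dual intro!: powr_mono2\<close>)
  fix G \<eta>
  assume G: "G \<le> F" "G \<noteq> bot"
    and lim: "\<And>x. ((\<lambda>i. blinfun_apply (p_dual p (v i)) x) \<longlongrightarrow> blinfun_apply \<eta> x) G"
  have vG: "(v \<longlongrightarrow> v0) G" and bdG: "eventually (\<lambda>i. norm (p_dual p (v i)) \<le> (norm v0 + 1) powr (p - 1)) G"
    using v bd G(1) tendsto_mono filter_leD by blast+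
  show "\<eta> = p_dual p v0"
  proof (rule p_dual_eqI)
    fix w
    have "((\<lambda>i. norm (v i) powr p / p + blinfun_apply (p_dual p (v i)) (w - v i)) \<longlongrightarrow>
        norm v0 powr p / p + blinfun_apply \<eta> (w - v0)) G"
      using p_gt_1
      by (intro tendsto_add tendsto_divide tendsto_powr' tendsto_norm tendsto_const vG
          weak_star_tendsto_apply[OF bdG lim] tendsto_diff) auto
    then show "norm v0 powr p / p + blinfun_apply \<eta> (w - v0) \<le> norm w powr p / p"
      by (rule tendsto_upperbound) (use G(2) in \<open>simp_all add: p_dual_subgradient\<close>)
  qed
qed

lemma norm_powr_has_derivative:
  "((\<lambda>t. norm (v + t *\<^sub>R h) powr p / p) has_real_derivative blinfun_apply (p_dual p (v :: 'a)) h) (at 0)"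
proof (rule subgradient_selection_derivative[where g = "\<lambda>v. norm v powr p / p"])
  have "((\<lambda>t::real. v + t *\<^sub>R h) \<longlongrightarrow> v + 0 *\<^sub>R h) (at 0)"
    by (intro tendsto_intros)
  then show "((\<lambda>t. blinfun_apply (p_dual p (v + t *\<^sub>R h)) h) \<longlongrightarrow> blinfun_apply (p_dual p v) h) (at 0)"
    by (intro p_dual_weak_star_continuous) simp
qed (rule p_dual_subgradient)

end

subsection \<open>The resolvent\<close>

text \<open>This is the perspective \<epsilon> g(z/\<epsilon>) of g = norm^p / p, so its gradient at
  \<open>z\<close> is that of g at z/\<epsilon>, with no extra factor.\<close>

definition penalty :: "real \<Rightarrow> real \<Rightarrow> 'a::real_normed_vector \<Rightarrow> real" where
  "penalty p \<epsilon> z = \<epsilon> / p * (norm z / \<epsilon>) powr p"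

locale regularization =
  fixes f :: "'a::real_normed_vector \<Rightarrow> ereal" and p :: real
  assumes reflexive: "reflexive_space TYPE('a)"
    and strictly_convex: "strictly_convex_space TYPE('a)"
    and smooth: "smooth_space TYPE('a)"
    and p_gt_1: "p > 1"
    and f_not_MInf: "f u \<noteq> -\<infinity>"
    and f_proper: "proper_fun f"
    and f_lsc: "lower_semicontinuous f"
    and f_convex: "convex_fun f"
begin

abbreviation "pen \<equiv> penalty p :: real \<Rightarrow> 'a \<Rightarrow> real"

lemma penalty_eq:
  assumes "\<epsilon> > 0"
  shows "pen \<epsilon> z = 1 / (p * \<epsilon> powr (p - 1)) * norm z powr p"
  using assms by (simp add: penalty_def powr_divide powr_diff field_simps)

lemma penalty_eq_scaled:
  assumes "\<epsilon> > 0"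
  shows "pen \<epsilon> z = \<epsilon> * (norm (z /\<^sub>R \<epsilon>) powr p / p)"
  using assms by (simp add: penalty_def divide_inverse mult.commute)

lemma penalty_nonneg: "\<epsilon> > 0 \<Longrightarrow> pen \<epsilon> z \<ge> 0"
  using p_gt_1 by (simp add: penalty_def)

lemma penalty_0: "pen \<epsilon> 0 = 0"
  by (simp add: penalty_def)

lemma penalty_subgradient:
  assumes "\<epsilon> > 0"
  shows "pen \<epsilon> z + blinfun_apply (p_dual p (z /\<^sub>R \<epsilon>)) (w - z) \<le> pen \<epsilon> w"
proof -
  have "\<epsilon> * (norm (z /\<^sub>R \<epsilon>) powr p / p + blinfun_apply (p_dual p (z /\<^sub>R \<epsilon>)) (w /\<^sub>R \<epsilon> - z /\<^sub>R \<epsilon>))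
      \<le> \<epsilon> * (norm (w /\<^sub>R \<epsilon>) powr p / p)"
    using assms by (intro mult_left_mono p_dual_subgradient[OF smooth p_gt_1]) auto
  then show ?thesis
    using assms
    by (simp add: penalty_eq_scaled blinfun.diff_right blinfun.scaleR_right distrib_left right_diff_distrib
        mult.assoc[symmetric])
qed

lemma penalty_has_derivative:
  assumes "\<epsilon> > 0"
  shows "((\<lambda>t. pen \<epsilon> (z + t *\<^sub>R h)) has_real_derivative blinfun_apply (p_dual p (z /\<^sub>R \<epsilon>)) h) (at 0)"
proof -
  have "((\<lambda>t. \<epsilon> * (norm (z /\<^sub>R \<epsilon> + t *\<^sub>R (h /\<^sub>R \<epsilon>)) powr p / p)) has_real_derivative
      \<epsilon> * blinfun_apply (p_dual p (z /\<^sub>R \<epsilon>)) (h /\<^sub>R \<epsilon>)) (at 0)"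
    by (intro DERIV_cmult norm_powr_has_derivative smooth p_gt_1)
  moreover have "z /\<^sub>R \<epsilon> + t *\<^sub>R (h /\<^sub>R \<epsilon>) = (z + t *\<^sub>R h) /\<^sub>R \<epsilon>" for t
    by (simp add: scaleR_add_right mult.commute)
  ultimately show ?thesis
    using assms by (simp add: penalty_eq_scaled blinfun.scaleR_right mult.assoc[symmetric])
qed

lemma penalty_strictly_convex:
  assumes "\<epsilon> > 0" "x \<noteq> y" "0 < t" "t < 1"
  shows "pen \<epsilon> (t *\<^sub>R x + (1 - t) *\<^sub>R y) < t * pen \<epsilon> x + (1 - t) * pen \<epsilon> y"
proof -
  define k where "k = 1 / (p * \<epsilon> powr (p - 1))"
  have "k > 0"
    using assms(1) p_gt_1 by (simp add: k_def)
  then have "k * norm (t *\<^sub>R x + (1 - t) *\<^sub>R y) powr p < k * (t * norm x powr p + (1 - t) * norm y powr p)"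
    using norm_powr_strictly_convex[OF strictly_convex p_gt_1 assms(2-4)] by simp
  then show ?thesis
    unfolding penalty_eq[OF assms(1)] k_def[symmetric] by (simp add: algebra_simps)
qed

lemma penalty_convex:
  assumes "\<epsilon> > 0" "0 < t" "t < 1"
  shows "pen \<epsilon> (t *\<^sub>R x + (1 - t) *\<^sub>R y) \<le> t * pen \<epsilon> x + (1 - t) * pen \<epsilon> y"
proof (cases "x = y")
  case True
  then show ?thesis
    by (simp add: algebra_simps)
next
  case False
  show ?thesis
    using penalty_strictly_convex[OF assms(1) False assms(2,3)] by simp
qed

lemma penalty_tendsto:
  assumes "(e \<longlongrightarrow> \<epsilon>) F" "(z \<longlongrightarrow> y) F" "\<epsilon> > 0"
  shows "((\<lambda>i. pen (e i) (z i)) \<longlongrightarrow> pen \<epsilon> y) F"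
proof -
  have ev: "eventually (\<lambda>i. e i > 0) F"
    using order_tendstoD(1)[OF assms(1,3)] .
  show ?thesis
    unfolding penalty_def using p_gt_1 assms(3)
    by (intro tendsto_mult tendsto_divide tendsto_powr' tendsto_norm tendsto_const assms(1,2))
      (auto intro: eventually_mono[OF ev])
qed

text \<open>The radius solves (norm z / \<epsilon>)^(p-1) = p K. Being proportional to \<epsilon>,
  it serves both for coercivity and for \<epsilon> \<rightarrow> 0.\<close>

lemma penalty_growth:
  assumes "\<epsilon> > 0" "K \<ge> 0" "norm z \<ge> \<epsilon> * (p * K) powr (1 / (p - 1))"
  shows "K * norm z \<le> pen \<epsilon> z"
proof -
  have "p * K = ((p * K) powr (1 / (p - 1))) powr (p - 1)"
    using assms(2) p_gt_1 by (simp add: powr_powr)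
  also have "\<dots> \<le> (norm z / \<epsilon>) powr (p - 1)"
    using assms p_gt_1 by (intro powr_mono2) (auto simp: field_simps)
  finally have "K * norm z \<le> (norm z / \<epsilon>) powr (p - 1) / p * norm z"
    using p_gt_1 by (intro mult_right_mono) (auto simp: field_simps)
  also have "\<dots> = pen \<epsilon> z"
    using assms(1) by (cases "z = 0") (simp_all add: penalty_def powr_diff)
  finally show ?thesis .
qed

section \<open>Lower bounds and coercivity of the objective\<close>

text \<open>Moves inequalities to real arithmetic. Outside the effective domain it has the default
  value 0, so statements about it are restricted to \<open>eff_dom f\<close>.\<close>

definition fr :: "'a \<Rightarrow> real" where
  "fr v = real_of_ereal (f v)"

lemma f_eq: "v \<in> eff_dom f \<Longrightarrow> f v = ereal (fr v)"
  using f_not_MInf[of v] by (cases "f v") (auto simp: eff_dom_def fr_def)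

lemma f_outside: "v \<notin> eff_dom f \<Longrightarrow> f v = \<infinity>"
  by (auto simp: eff_dom_def)

lemma fr_convex:
  assumes "x \<in> eff_dom f" "y \<in> eff_dom f" "0 < t" "t < 1"
  shows "t *\<^sub>R x + (1 - t) *\<^sub>R y \<in> eff_dom f"
    "fr (t *\<^sub>R x + (1 - t) *\<^sub>R y) \<le> t * fr x + (1 - t) * fr y"
proof -
  have le: "f (t *\<^sub>R x + (1 - t) *\<^sub>R y) \<le> ereal (t * fr x + (1 - t) * fr y)"
  proof -
    have "f (t *\<^sub>R x + (1 - t) *\<^sub>R y) \<le> ereal t * f x + ereal (1 - t) * f y"
      using f_convex assms(3,4) unfolding convex_fun_def by simp
    then show ?thesis
      by (simp add: f_eq assms(1,2))
  qed
  then show dom: "t *\<^sub>R x + (1 - t) *\<^sub>R y \<in> eff_dom f"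
    unfolding eff_dom_def by (auto intro: le_less_trans)
  show "fr (t *\<^sub>R x + (1 - t) *\<^sub>R y) \<le> t * fr x + (1 - t) * fr y"
    using le f_eq[OF dom] by simp
qed

lemma subdifferential_iff:
  assumes "u \<in> eff_dom f"
  shows "\<xi> \<in> subdifferential f u \<longleftrightarrow>
    (\<forall>w\<in>eff_dom f. fr u + blinfun_apply \<xi> (w - u) \<le> fr w)" (is "?L \<longleftrightarrow> ?R")
proof -
  have "f u - f w \<le> ereal (blinfun_apply \<xi> (u - w)) \<longleftrightarrow>
      (w \<in> eff_dom f \<longrightarrow> fr u + blinfun_apply \<xi> (w - u) \<le> fr w)" for w
    using f_eq[OF assms] f_eq[of w] f_outside[of w]
    by (cases "w \<in> eff_dom f") (auto simp: blinfun.diff_right)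
  then show ?thesis
    using assms by (auto simp: subdifferential_def)
qed

lemma subdifferential_dom: "\<xi> \<in> subdifferential f u \<Longrightarrow> u \<in> eff_dom f"
  by (simp add: subdifferential_def)

text \<open>Lower semicontinuity bounds \<open>f\<close> below near one point of its domain, and convexity
  propagates this to a bound with linear growth; no affine minorant is needed.\<close>

lemma linear_minorant:
  obtains a b where "b \<ge> 0" "\<And>v. v \<in> eff_dom f \<Longrightarrow> a - b * norm v \<le> fr v"
proof -
  obtain x where x: "x \<in> eff_dom f"
    using f_proper by (auto simp: proper_fun_def)
  have "eventually (\<lambda>v. ereal (fr x - 1) < f v) (nhds x)"
    using f_lsc f_eq[OF x] unfolding lower_semicontinuous_def by simp
  then obtain r where r: "r > 0" "\<And>v. dist v x < r \<Longrightarrow> ereal (fr x - 1) < f v"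
    unfolding eventually_nhds_metric by blast
  have near: "fr x - 1 < fr v" if "v \<in> eff_dom f" "norm (v - x) < r" for v
    using r(2)[of v] f_eq[OF that(1)] that(2) by (simp add: dist_norm)
  have bound: "fr x - 1 - 2 / r * norm (v - x) \<le> fr v" if v: "v \<in> eff_dom f" for v
  proof (cases "norm (v - x) < r")
    case True
    then show ?thesis
      using near[OF v] r(1) by (smt (verit) divide_nonneg_pos mult_nonneg_nonneg norm_ge_zero)
  next
    case False
    define s where "s = norm (v - x)"
    \<comment> \<open>This puts \<open>w\<close> at distance r/2 from \<open>x\<close>, inside the
      ball where \<open>f\<close> is bounded below; the resulting slope is 2/r.\<close>
    define t where "t = r / (2 * s)"
    have s: "s \<ge> r" "s > 0"
      using False r(1) by (auto simp: s_def)
    then have t: "0 < t" "t < 1"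
      using r(1) by (auto simp: t_def field_simps)
    define w where "w = t *\<^sub>R v + (1 - t) *\<^sub>R x"
    have "w - x = t *\<^sub>R (v - x)"
      by (simp add: w_def algebra_simps)
    then have "norm (w - x) = t * s"
      using t by (simp add: s_def)
    then have "norm (w - x) < r"
      using s r(1) by (simp add: t_def)
    then have "fr x - 1 < t * fr v + (1 - t) * fr x"
      using near[of w] fr_convex[OF v x t] unfolding w_def by linarith
    then have "t * (fr x - fr v) < 1"
      by (simp add: algebra_simps)
    then have "fr x - fr v < 1 / t"
      using t by (simp add: field_simps)
    moreover have "1 / t = 2 / r * s"
      using s r(1) by (simp add: t_def)
    ultimately show ?thesis
      by (simp add: s_def)
  qed
  have "(fr x - 1 - 2 / r * norm x) - 2 / r * norm v \<le> fr v" if v: "v \<in> eff_dom f" for v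
  proof -
    have "2 / r * norm (v - x) \<le> 2 / r * (norm v + norm x)"
      using r(1) by (intro mult_left_mono norm_triangle_ineq4) auto
    then show ?thesis
      using bound[OF v] by (simp add: algebra_simps add_divide_distrib)
  qed
  with that[of "2 / r" "fr x - 1 - 2 / r * norm x"] r(1) show ?thesis
    by simp
qed

text \<open>Growth with constant b + 1 absorbs the linear loss of \<open>f\<close> and leaves one
  norm over. The constants depend on neither \<epsilon> nor \<open>u\<close>, which later gives
  locally uniform bounds.\<close>

lemma coercive:
  obtains a b T where "b \<ge> 0" "T \<ge> 0"
    "\<And>\<epsilon> u v. \<epsilon> > 0 \<Longrightarrow> v \<in> eff_dom f \<Longrightarrow>
      norm (u - v) \<le> \<epsilon> * T + (pen \<epsilon> (u - v) + fr v - a + b * norm u + b * \<epsilon> * T)"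
proof -
  obtain a b where b: "b \<ge> 0" and ab: "\<And>v. v \<in> eff_dom f \<Longrightarrow> a - b * norm v \<le> fr v"
    using linear_minorant by metis
  define T where "T = (p * (b + 1)) powr (1 / (p - 1))"
  have "norm (u - v) \<le> \<epsilon> * T + (pen \<epsilon> (u - v) + fr v - a + b * norm u + b * \<epsilon> * T)"
    if \<epsilon>: "\<epsilon> > 0" and v: "v \<in> eff_dom f" for \<epsilon> u v
  proof -
    have "norm v \<le> norm u + norm (u - v)"
      by (metis norm_minus_commute norm_triangle_sub)
    then have "b * norm v \<le> b * norm u + b * norm (u - v)"
      using b by (metis distrib_left mult_left_mono)
    then have 1: "a - b * norm u - b * norm (u - v) \<le> fr v"
      using ab[OF v] by simp
    have 2: "0 \<le> \<epsilon> * T" "0 \<le> b * \<epsilon> * T"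
      using \<epsilon> b by (simp_all add: T_def)
    show ?thesis
    proof (cases "norm (u - v) \<ge> \<epsilon> * T")
      case True
      then have "(b + 1) * norm (u - v) \<le> pen \<epsilon> (u - v)"
        using penalty_growth[OF \<epsilon>, of "b + 1" "u - v"] b by (simp add: T_def)
      with 1 2 show ?thesis
        by (simp add: distrib_right)
    next
      case False
      then have "b * norm (u - v) \<le> b * \<epsilon> * T"
        using b mult_left_mono[of "norm (u - v)" "\<epsilon> * T" b] by simp
      with 1 False penalty_nonneg[OF \<epsilon>, of "u - v"] show ?thesis
        by linarith
    qed
  qed
  moreover have "T \<ge> 0"
    by (simp add: T_def)
  ultimately show ?thesis
    using b that by blast
qed

text \<open>The slope of the penalty away from its growth radius can be made arbitrary as that
  radius shrinks with \<epsilon>. Also available for \<open>u\<close> outside the domain, where it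
  drives the envelope to infinity.\<close>

lemma far_points_cost:
  assumes "r > 0"
  shows "eventually (\<lambda>\<epsilon>. \<forall>v\<in>eff_dom f. norm (u - v) \<ge> r \<longrightarrow> K \<le> pen \<epsilon> (u - v) + fr v) (at_right 0)"
proof -
  obtain a b where b: "b \<ge> 0" and ab: "\<And>v. v \<in> eff_dom f \<Longrightarrow> a - b * norm v \<le> fr v"
    using linear_minorant by metis
  \<comment> \<open>Beyond the loss \<open>b\<close>, the surplus slope times r pays for K - a + b
    norm u.\<close>
  define M where "M = b + max 0 (K - a + b * norm u) / r"
  define T where "T = (p * M) powr (1 / (p - 1))"
  have M: "M \<ge> b"
    using assms by (simp add: M_def)
  have T: "T \<ge> 0"
    by (simp add: T_def)
  \<comment> \<open>Then \<epsilon> T < r, so points at distance r lie beyond the growth radius;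
    adding 1 keeps the quotient meaningful for T = 0.\<close>
  have "eventually (\<lambda>\<epsilon>. \<epsilon> \<in> {0<..<r / (T + 1)}) (at_right 0)"
    using assms T by (intro eventually_at_right_real) auto
  then show ?thesis
  proof eventually_elim
    case (elim \<epsilon>)
    then have \<epsilon>: "\<epsilon> > 0" "\<epsilon> * (T + 1) < r"
      using T by (auto simp: field_simps)
    show ?case
    proof (intro ballI impI)
      fix v
      assume v: "v \<in> eff_dom f" and far: "norm (u - v) \<ge> r"
      have "norm (u - v) \<ge> \<epsilon> * T"
        using far \<epsilon> by (simp add: distrib_left)
      then have 1: "M * norm (u - v) \<le> pen \<epsilon> (u - v)"
        using penalty_growth[OF \<epsilon>(1), of M "u - v"] M b by (simp add: T_def)
      have "norm v \<le> norm u + norm (u - v)"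
        by (metis norm_minus_commute norm_triangle_sub)
      then have 2: "b * norm v \<le> b * norm u + b * norm (u - v)"
        using b by (metis distrib_left mult_left_mono)
      have "(M - b) * r \<le> (M - b) * norm (u - v)"
        using M far by (intro mult_left_mono) auto
      moreover have "K - a + b * norm u \<le> (M - b) * r"
        using assms by (simp add: M_def)
      ultimately show "K \<le> pen \<epsilon> (u - v) + fr v"
        using 1 2 ab[OF v] by (simp add: left_diff_distrib)
    qed
  qed
qed

lemma sublevel_closed:
  assumes "\<epsilon> > 0"
  shows "closed {v \<in> eff_dom f. pen \<epsilon> (u - v) + fr v \<le> c}" (is "closed ?S")
proof -
  have "open (- ?S)"
  proof (rule topological_space_class.openI)
    fix v
    assume "v \<in> - ?S"
    \<comment> \<open>Points outside the effective domain satisfy this too, with an infinite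
      right-hand side, so the whole complement is treated at once. The value \<open>d\<close> then
      splits the margin between penalty and \<open>f\<close>.\<close>
    then have "ereal (c - pen \<epsilon> (u - v)) < f v"
      using f_eq[of v] f_outside[of v] by (cases "v \<in> eff_dom f") auto
    then obtain d where d: "ereal (c - pen \<epsilon> (u - v)) < ereal d" "ereal d < f v"
      using ereal_dense2 by blast
    have "((\<lambda>w. pen \<epsilon> (u - w)) \<longlongrightarrow> pen \<epsilon> (u - v)) (nhds v)"
      by (intro penalty_tendsto[OF tendsto_const _ assms] tendsto_diff tendsto_const filterlim_ident)
    then have "eventually (\<lambda>w. c - d < pen \<epsilon> (u - w)) (nhds v)"
      by (rule order_tendstoD) (use d in simp)
    moreover have "eventually (\<lambda>w. ereal d < f w) (nhds v)"
      using f_lsc d(2) unfolding lower_semicontinuous_def by blast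
    ultimately have "eventually (\<lambda>w. w \<in> - ?S) (nhds v)"
      by eventually_elim (use f_eq in fastforce)
    then show "\<exists>T. open T \<and> v \<in> T \<and> T \<subseteq> - ?S"
      unfolding eventually_nhds by blast
  qed
  then show ?thesis
    by (simp add: open_closed)
qed

section \<open>Existence and uniqueness of the minimizer\<close>

text \<open>Convexity is stated jointly in base point and competitor: equal base points give convex
  sublevel sets and uniqueness, different ones give convexity of the envelope.\<close>

lemma objective_convex:
  assumes "\<epsilon> > 0" "v \<in> eff_dom f" "w \<in> eff_dom f" "0 < t" "t < 1"
  shows "pen \<epsilon> ((t *\<^sub>R x + (1 - t) *\<^sub>R y) - (t *\<^sub>R v + (1 - t) *\<^sub>R w)) + fr (t *\<^sub>R v + (1 - t) *\<^sub>R w)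
    \<le> t * (pen \<epsilon> (x - v) + fr v) + (1 - t) * (pen \<epsilon> (y - w) + fr w)"
    and "x - v \<noteq> y - w \<Longrightarrow> pen \<epsilon> ((t *\<^sub>R x + (1 - t) *\<^sub>R y) - (t *\<^sub>R v + (1 - t) *\<^sub>R w)) + fr (t *\<^sub>R v + (1 - t) *\<^sub>R w)
    < t * (pen \<epsilon> (x - v) + fr v) + (1 - t) * (pen \<epsilon> (y - w) + fr w)"
proof -
  have eq: "(t *\<^sub>R x + (1 - t) *\<^sub>R y) - (t *\<^sub>R v + (1 - t) *\<^sub>R w) = t *\<^sub>R (x - v) + (1 - t) *\<^sub>R (y - w)"
    by (simp add: algebra_simps)
  show "pen \<epsilon> ((t *\<^sub>R x + (1 - t) *\<^sub>R y) - (t *\<^sub>R v + (1 - t) *\<^sub>R w)) + fr (t *\<^sub>R v + (1 - t) *\<^sub>R w)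
    \<le> t * (pen \<epsilon> (x - v) + fr v) + (1 - t) * (pen \<epsilon> (y - w) + fr w)"
    unfolding eq distrib_left
    using penalty_convex[OF assms(1,4,5), of "x - v" "y - w"] fr_convex(2)[OF assms(2-5)] by linarith
  assume "x - v \<noteq> y - w"
  then show "pen \<epsilon> ((t *\<^sub>R x + (1 - t) *\<^sub>R y) - (t *\<^sub>R v + (1 - t) *\<^sub>R w)) + fr (t *\<^sub>R v + (1 - t) *\<^sub>R w)
    < t * (pen \<epsilon> (x - v) + fr v) + (1 - t) * (pen \<epsilon> (y - w) + fr w)"
    unfolding eq distrib_left
    using penalty_strictly_convex[OF assms(1) _ assms(4,5), of "x - v" "y - w"] fr_convex(2)[OF assms(2-5)]
    by linarith
qed

lemma sublevel_convex:
  assumes "\<epsilon> > 0"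
  shows "convex {v \<in> eff_dom f. pen \<epsilon> (u - v) + fr v \<le> c}" (is "convex ?S")
  unfolding convex_contains_open_segment
proof (intro ballI subsetI)
  fix v w z
  assume vw: "v \<in> ?S" "w \<in> ?S" and "z \<in> open_segment v w"
  then obtain t where t: "0 < t" "t < 1" and z: "z = (1 - t) *\<^sub>R v + t *\<^sub>R w"
    by (auto simp: in_segment)
  have z': "z = t *\<^sub>R w + (1 - t) *\<^sub>R v"
    by (simp add: z add.commute)
  have "pen \<epsilon> (u - z) + fr z \<le> t * (pen \<epsilon> (u - w) + fr w) + (1 - t) * (pen \<epsilon> (u - v) + fr v)"
    using objective_convex(1)[OF assms _ _ t, of w v u u] vw unfolding z'
    by (simp add: scaleR_add_left[symmetric])
  also have "\<dots> \<le> t * c + (1 - t) * c"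
    using vw t by (intro add_mono mult_left_mono) auto
  finally show "z \<in> ?S"
    using fr_convex(1)[OF _ _ t, of w v] vw by (simp add: z' algebra_simps)
qed

lemma minimizer_exists:
  assumes \<epsilon>: "\<epsilon> > 0"
  obtains v where "v \<in> eff_dom f" "\<And>w. w \<in> eff_dom f \<Longrightarrow> pen \<epsilon> (u - v) + fr v \<le> pen \<epsilon> (u - w) + fr w"
proof -
  define g where "g v = pen \<epsilon> (u - v) + fr v" for v
  obtain a b T where bT: "b \<ge> 0" "T \<ge> 0" and
    co: "\<And>\<epsilon> u v. \<epsilon> > 0 \<Longrightarrow> v \<in> eff_dom f \<Longrightarrow>
      norm (u - v) \<le> \<epsilon> * T + (pen \<epsilon> (u - v) + fr v - a + b * norm u + b * \<epsilon> * T)"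
    by (rule coercive) (rule that)
  define R where "R = \<epsilon> * T - a + b * norm u + b * \<epsilon> * T"
  have co: "norm (u - v) \<le> g v + R" if "v \<in> eff_dom f" for v
    using co[OF \<epsilon> that, of u] by (simp add: g_def R_def)
  have ne: "eff_dom f \<noteq> {}"
    using f_proper by (simp add: proper_fun_def)
  have bdd: "bdd_below (g ` eff_dom f)"
  proof (rule bdd_belowI2)
    show "- R \<le> g v" if "v \<in> eff_dom f" for v
      using co[OF that] norm_ge_zero[of "u - v"] by linarith
  qed
  define m where "m = Inf (g ` eff_dom f)"
  have "\<exists>v\<in>eff_dom f. g v < m + 1 / real (Suc n)" for n
    using cInf_lessD[of "g ` eff_dom f" "m + 1 / real (Suc n)"] ne by (auto simp: m_def)
  then obtain v where v: "\<And>n. v n \<in> eff_dom f" "\<And>n. g (v n) < m + 1 / real (Suc n)"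
    by metis
  have "norm (v n) \<le> norm u + (m + 1 + R)" for n
  proof -
    have "1 / real (Suc n) \<le> 1"
      by simp
    then have "norm (u - v n) \<le> m + 1 + R"
      using co[OF v(1)[of n]] v(2)[of n] by linarith
    then show ?thesis
      by (smt (verit) norm_minus_commute norm_triangle_sub)
  qed
  then have "eventually (\<lambda>n. norm (v n) \<le> norm u + (m + 1 + R)) sequentially"
    by simp
  then obtain G w where G: "G \<le> sequentially" "G \<noteq> bot"
    and lim: "\<And>\<xi> :: 'a \<Rightarrow>\<^sub>L real. ((\<lambda>n. blinfun_apply \<xi> (v n)) \<longlongrightarrow> blinfun_apply \<xi> w) G"
    by (rule weak_cluster_reflexive[OF reflexive sequentially_bot]) (rule that)
  \<comment> \<open>The sequence is eventually in every sublevel set above the infimum. These sets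
    are closed and convex, hence weakly closed, so \<open>w\<close> lies in all of them.\<close>
  have w: "w \<in> eff_dom f \<and> g w \<le> c" if "c > m" for c
  proof -
    have "(\<lambda>n. m + 1 / real (Suc n)) \<longlonglongrightarrow> m + 0"
      by (intro tendsto_add tendsto_const LIMSEQ_Suc[OF lim_1_over_n])
    then have "eventually (\<lambda>n. m + 1 / real (Suc n) < c) sequentially"
      by (rule order_tendstoD) (use that in simp)
    then have "eventually (\<lambda>n. v n \<in> {v \<in> eff_dom f. pen \<epsilon> (u - v) + fr v \<le> c}) sequentially"
    proof eventually_elim
      case (elim n)
      then show ?case
        using v(1)[of n] v(2)[of n] by (simp add: g_def)
    qed
    then have "eventually (\<lambda>n. v n \<in> {v \<in> eff_dom f. pen \<epsilon> (u - v) + fr v \<le> c}) G"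
      using G(1) filter_leD by blast
    then have "w \<in> {v \<in> eff_dom f. pen \<epsilon> (u - v) + fr v \<le> c}"
      by (rule weakly_closed_convex[OF sublevel_closed[OF \<epsilon>] sublevel_convex[OF \<epsilon>] G(2) _ lim])
    then show ?thesis
      by (simp add: g_def)
  qed
  then have "w \<in> eff_dom f" "g w \<le> m"
    using w[of "m + 1"] w by (auto intro: dense_ge)
  moreover have "m \<le> g x" if "x \<in> eff_dom f" for x
    unfolding m_def using bdd that by (intro cInf_lower) auto
  ultimately show ?thesis
    using that[of w] unfolding g_def by force
qed

lemma minimizer_unique:
  assumes \<epsilon>: "\<epsilon> > 0" and v: "v \<in> eff_dom f" "w \<in> eff_dom f"
    and min: "\<And>x. x \<in> eff_dom f \<Longrightarrow> pen \<epsilon> (u - v) + fr v \<le> pen \<epsilon> (u - x) + fr x"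
      "\<And>x. x \<in> eff_dom f \<Longrightarrow> pen \<epsilon> (u - w) + fr w \<le> pen \<epsilon> (u - x) + fr x"
  shows "v = w"
proof (rule ccontr)
  assume "v \<noteq> w"
  then have ne: "u - v \<noteq> u - w"
    by simp
  define m where "m = (1/2) *\<^sub>R v + (1 - 1/2) *\<^sub>R w"
  have mid: "(1/2) *\<^sub>R u + (1 - 1/2) *\<^sub>R u = u"
    by (simp add: scaleR_add_left[symmetric])
  have "pen \<epsilon> (u - m) + fr m < 1/2 * (pen \<epsilon> (u - v) + fr v) + (1 - 1/2) * (pen \<epsilon> (u - w) + fr w)"
    using objective_convex(2)[OF \<epsilon> v, of "1/2" u u] ne unfolding mid m_def by simp
  moreover have "m \<in> eff_dom f"
    unfolding m_def by (intro fr_convex(1) v) auto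
  ultimately show False
    using min(1)[of m] min(2)[of v] min(1)[OF v(2)] v by force
qed

lemma objective_eq: "\<epsilon> > 0 \<Longrightarrow> my_objective p f \<epsilon> u v = ereal (pen \<epsilon> (u - v)) + f v"
  by (simp add: my_objective_def penalty_eq)

lemma objective_eq_real:
  "\<epsilon> > 0 \<Longrightarrow> v \<in> eff_dom f \<Longrightarrow> my_objective p f \<epsilon> u v = ereal (pen \<epsilon> (u - v) + fr v)"
  by (simp add: objective_eq f_eq)

lemma objective_outside: "\<epsilon> > 0 \<Longrightarrow> v \<notin> eff_dom f \<Longrightarrow> my_objective p f \<epsilon> u v = \<infinity>"
  by (simp add: objective_eq f_outside)

lemma is_arg_min_objective_iff:
  assumes \<epsilon>: "\<epsilon> > 0"
  shows "is_arg_min (my_objective p f \<epsilon> u) (\<lambda>_. True) v \<longleftrightarrow>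
    v \<in> eff_dom f \<and> (\<forall>w\<in>eff_dom f. pen \<epsilon> (u - v) + fr v \<le> pen \<epsilon> (u - w) + fr w)" (is "?L \<longleftrightarrow> ?R")
proof
  assume ?L
  then have L: "my_objective p f \<epsilon> u v \<le> my_objective p f \<epsilon> u w" for w
    by (simp add: is_arg_min_linorder)
  obtain x where x: "x \<in> eff_dom f"
    using f_proper by (auto simp: proper_fun_def)
  have "v \<in> eff_dom f"
    using L[of x] objective_eq_real[OF \<epsilon> x] objective_outside[OF \<epsilon>, of v] by fastforce
  then show ?R
    using L objective_eq_real[OF \<epsilon>] by (metis ereal_less_eq(3))
next
  assume R: ?R
  have "my_objective p f \<epsilon> u v \<le> my_objective p f \<epsilon> u w" for w
    using R objective_eq_real[OF \<epsilon>] objective_outside[OF \<epsilon>] by (cases "w \<in> eff_dom f") auto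
  then show ?L
    by (simp add: is_arg_min_linorder)
qed

abbreviation "J \<equiv> my_resolvent p f"

lemma ex1_minimizer:
  assumes "\<epsilon> > 0"
  shows "\<exists>!v. is_arg_min (my_objective p f \<epsilon> u) (\<lambda>_. True) v"
proof -
  obtain v where "v \<in> eff_dom f" "\<And>w. w \<in> eff_dom f \<Longrightarrow> pen \<epsilon> (u - v) + fr v \<le> pen \<epsilon> (u - w) + fr w"
    using minimizer_exists[OF assms] by blast
  then show ?thesis
    using minimizer_unique[OF assms] unfolding is_arg_min_objective_iff[OF assms] by blast
qed

lemma resolvent_is_arg_min:
  assumes "\<epsilon> > 0"
  shows "is_arg_min (my_objective p f \<epsilon> u) (\<lambda>_. True) (J \<epsilon> u)"
  unfolding my_resolvent_def arg_min_def using ex1_minimizer[OF assms] by (metis someI_ex)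

lemma resolvent_dom: "\<epsilon> > 0 \<Longrightarrow> J \<epsilon> u \<in> eff_dom f"
  and resolvent_min: "\<epsilon> > 0 \<Longrightarrow> w \<in> eff_dom f \<Longrightarrow>
    pen \<epsilon> (u - J \<epsilon> u) + fr (J \<epsilon> u) \<le> pen \<epsilon> (u - w) + fr w"
  using resolvent_is_arg_min is_arg_min_objective_iff by blast+

lemma moreau_eq_INF: "\<epsilon> > 0 \<Longrightarrow> moreau_yosida p f \<epsilon> u = (INF v. my_objective p f \<epsilon> u v)"
  by (simp add: moreau_yosida_def objective_eq penalty_def divide_inverse mult.commute)

lemma moreau_eq_objective:
  assumes "\<epsilon> > 0"
  shows "moreau_yosida p f \<epsilon> u = my_objective p f \<epsilon> u (J \<epsilon> u)"
proof -
  have "my_objective p f \<epsilon> u (J \<epsilon> u) \<le> my_objective p f \<epsilon> u w" for w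
    using resolvent_is_arg_min[OF assms, of u] by (simp add: is_arg_min_linorder)
  then show ?thesis
    unfolding moreau_eq_INF[OF assms] by (intro antisym INF_lower INF_greatest) auto
qed

abbreviation env :: "real \<Rightarrow> 'a \<Rightarrow> real" where
  "env \<epsilon> u \<equiv> real_of_ereal (moreau_yosida p f \<epsilon> u)"

lemma env_eq: "\<epsilon> > 0 \<Longrightarrow> env \<epsilon> u = pen \<epsilon> (u - J \<epsilon> u) + fr (J \<epsilon> u)"
  and moreau_eq: "\<epsilon> > 0 \<Longrightarrow> moreau_yosida p f \<epsilon> u = ereal (pen \<epsilon> (u - J \<epsilon> u) + fr (J \<epsilon> u))"
  by (simp_all add: moreau_eq_objective objective_eq_real resolvent_dom)

lemma env_le: "\<epsilon> > 0 \<Longrightarrow> w \<in> eff_dom f \<Longrightarrow> env \<epsilon> u \<le> pen \<epsilon> (u - w) + fr w"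
  using resolvent_min by (simp add: env_eq)

subsection \<open>Differentiability of the envelope\<close>

text \<open>Taken at u - J rather than J - u, so that no sign appears; the minus sign of the theorem
  comes from oddness of \<open>p_dual\<close>.\<close>

definition env_grad :: "real \<Rightarrow> 'a \<Rightarrow> ('a \<Rightarrow>\<^sub>L real)" where
  "env_grad \<epsilon> u = p_dual p ((u - J \<epsilon> u) /\<^sub>R \<epsilon>)"

lemma norm_env_grad: "\<epsilon> > 0 \<Longrightarrow> norm (env_grad \<epsilon> u) = (norm (u - J \<epsilon> u) / \<epsilon>) powr (p - 1)"
  by (simp add: env_grad_def norm_p_dual[OF smooth p_gt_1] divide_inverse mult.commute)

text \<open>Euler's identity for the p-homogeneous penalty; it converts pairings back into residual
  norms.\<close>

lemma env_grad_apply_self: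
  assumes "\<epsilon> > 0"
  shows "blinfun_apply (env_grad \<epsilon> u) (u - J \<epsilon> u) = p * pen \<epsilon> (u - J \<epsilon> u)"
proof -
  have "blinfun_apply (env_grad \<epsilon> u) ((u - J \<epsilon> u) /\<^sub>R \<epsilon>) = norm ((u - J \<epsilon> u) /\<^sub>R \<epsilon>) powr p"
    unfolding env_grad_def by (rule p_dual_apply_self[OF smooth p_gt_1])
  then have "inverse \<epsilon> * blinfun_apply (env_grad \<epsilon> u) (u - J \<epsilon> u) = norm ((u - J \<epsilon> u) /\<^sub>R \<epsilon>) powr p"
    by (simp only: blinfun.scaleR_right real_scaleR_def)
  then have "blinfun_apply (env_grad \<epsilon> u) (u - J \<epsilon> u) = \<epsilon> * norm ((u - J \<epsilon> u) /\<^sub>R \<epsilon>) powr p"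
    using assms by (simp only: inverse_eq_divide) (simp add: divide_eq_eq mult.commute)
  then show ?thesis
    using p_gt_1 unfolding penalty_eq_scaled[OF assms] by simp
qed

lemma penalty_env_grad:
  "\<epsilon> > 0 \<Longrightarrow> pen \<epsilon> (u - J \<epsilon> u) + blinfun_apply (env_grad \<epsilon> u) (w - (u - J \<epsilon> u)) \<le> pen \<epsilon> w"
  unfolding env_grad_def by (rule penalty_subgradient)

text \<open>Moving the competitor from the resolvent towards \<open>w\<close> shifts the residual
  along \<open>d\<close>. Minimality and convexity of \<open>f\<close> bound the quotient of the
  penalty from below, and differentiability of the penalty identifies its limit.\<close>

lemma env_grad_subgradient_f:
  assumes \<epsilon>: "\<epsilon> > 0" and w: "w \<in> eff_dom f"
  shows "fr (J \<epsilon> u) + blinfun_apply (env_grad \<epsilon> u) (w - J \<epsilon> u) \<le> fr w"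
proof -
  define z where "z = u - J \<epsilon> u"
  define d where "d = J \<epsilon> u - w"
  define q where "q t = pen \<epsilon> (z + t *\<^sub>R d)" for t
  have dom: "J \<epsilon> u \<in> eff_dom f"
    by (rule resolvent_dom[OF \<epsilon>])
  have "(q has_real_derivative blinfun_apply (env_grad \<epsilon> u) d) (at 0)"
    unfolding q_def env_grad_def z_def by (rule penalty_has_derivative[OF \<epsilon>])
  then have "((\<lambda>t. (q t - q 0) / t) \<longlongrightarrow> blinfun_apply (env_grad \<epsilon> u) d) (at 0)"
    by (simp add: DERIV_def)
  then have "((\<lambda>t. (q t - q 0) / t) \<longlongrightarrow> blinfun_apply (env_grad \<epsilon> u) d) (at_right 0)"
    by (rule tendsto_mono[OF at_le, rotated]) simp
  moreover have "eventually (\<lambda>t. fr (J \<epsilon> u) - fr w \<le> (q t - q 0) / t) (at_right 0)"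
    using eventually_at_right_real[OF zero_less_one]
  proof (eventually_elim, clarsimp)
    fix t :: real
    assume t: "0 < t" "t < 1"
    define x where "x = t *\<^sub>R w + (1 - t) *\<^sub>R J \<epsilon> u"
    have "u - x = z + t *\<^sub>R d"
      by (simp add: x_def z_def d_def algebra_simps)
    moreover have "pen \<epsilon> z + fr (J \<epsilon> u) \<le> pen \<epsilon> (u - x) + fr x"
      unfolding z_def x_def by (intro resolvent_min \<epsilon> fr_convex(1) w dom t)
    ultimately have "q 0 + fr (J \<epsilon> u) \<le> q t + (t * fr w + (1 - t) * fr (J \<epsilon> u))"
      using fr_convex(2)[OF w dom t] by (simp add: q_def x_def)
    then show "fr (J \<epsilon> u) - fr w \<le> (q t - q 0) / t"
      using t by (subst pos_le_divide_eq) (simp_all add: algebra_simps)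
  qed
  ultimately have "fr (J \<epsilon> u) - fr w \<le> blinfun_apply (env_grad \<epsilon> u) d"
    by (rule tendsto_lowerbound) simp
  then show ?thesis
    by (simp add: d_def blinfun.diff_right)
qed

text \<open>Add the subgradient inequality of the penalty at the residual of \<open>w\<close> to
  that of \<open>f\<close> at the resolvent of \<open>w\<close>: the two arguments sum to
  \<open>w\<close>, and one functional serves both terms.\<close>

lemma env_subgradient:
  assumes \<epsilon>: "\<epsilon> > 0"
  shows "env \<epsilon> u + blinfun_apply (env_grad \<epsilon> u) (w - u) \<le> env \<epsilon> w"
  using penalty_env_grad[OF \<epsilon>, of u "w - J \<epsilon> w"]
    env_grad_subgradient_f[OF \<epsilon> resolvent_dom[OF \<epsilon>, of w], of u]
  by (simp add: env_eq[OF \<epsilon>] blinfun.diff_right)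

text \<open>Comparison with one fixed point of the domain: its cost, inserted in the coercivity
  estimate, is continuous in \<epsilon> and \<open>u\<close>.\<close>

lemma residual_bounded:
  assumes \<epsilon>: "\<epsilon> > 0" and u: "(u \<longlongrightarrow> u0) F" and e: "(e \<longlongrightarrow> \<epsilon>) F"
  obtains R where "eventually (\<lambda>i. norm (u i - J (e i) (u i)) \<le> R) F"
proof -
  obtain a b T where bT: "b \<ge> 0" "T \<ge> 0" and
    co: "\<And>\<epsilon> u v. \<epsilon> > 0 \<Longrightarrow> v \<in> eff_dom f \<Longrightarrow>
      norm (u - v) \<le> \<epsilon> * T + (pen \<epsilon> (u - v) + fr v - a + b * norm u + b * \<epsilon> * T)"
    by (rule coercive) (rule that)
  obtain x where x: "x \<in> eff_dom f"
    using f_proper by (auto simp: proper_fun_def)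
  define B where "B \<epsilon> u = \<epsilon> * T + (pen \<epsilon> (u - x) + fr x - a + b * norm u + b * \<epsilon> * T)" for \<epsilon> u
  have "((\<lambda>i. B (e i) (u i)) \<longlongrightarrow> B \<epsilon> u0) F"
    unfolding B_def by (intro tendsto_intros penalty_tendsto u e \<epsilon>)
  then have "eventually (\<lambda>i. B (e i) (u i) < B \<epsilon> u0 + 1) F"
    by (rule order_tendstoD) simp
  moreover have "eventually (\<lambda>i. e i > 0) F"
    by (rule order_tendstoD(1)[OF e \<epsilon>])
  ultimately have "eventually (\<lambda>i. norm (u i - J (e i) (u i)) \<le> B \<epsilon> u0 + 1) F"
  proof eventually_elim
    case (elim i)
    then show ?case
      using co[OF elim(2) resolvent_dom[OF elim(2)], of "u i" "u i"] resolvent_min[OF elim(2) x, of "u i"]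
      unfolding B_def by linarith
  qed
  then show ?thesis
    by (rule that)
qed

text \<open>
  Joint continuity in \<open>\<epsilon>\<close> and \<open>u\<close>. The Fenchel--Young gap of the \<open>i\<close>-th gradient with respect to
  the limiting penalty at \<open>u0 - J \<epsilon> u0\<close> is at most \<open>err i\<close>, which tends to zero; since the penalty
  is differentiable, this forces the gradients and their conjugate values \<open>D i\<close> to converge.
  No convergence of the resolvents themselves is used.
\<close>

lemma env_grad_continuous:
  assumes \<epsilon>: "\<epsilon> > 0" and u: "(u \<longlongrightarrow> u0) F" and e: "(e \<longlongrightarrow> \<epsilon>) F"
  shows "((\<lambda>i. blinfun_apply (env_grad (e i) (u i)) x) \<longlongrightarrow> blinfun_apply (env_grad \<epsilon> u0) x) F"
    and "((\<lambda>i. norm (u i - J (e i) (u i))) \<longlongrightarrow> norm (u0 - J \<epsilon> u0)) F"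
proof -
  define A where "A i = env_grad (e i) (u i)" for i
  define z where "z i = u i - J (e i) (u i)" for i
  define A0 where "A0 = env_grad \<epsilon> u0"
  define z0 where "z0 = u0 - J \<epsilon> u0"
  obtain R where R: "eventually (\<lambda>i. norm (z i) \<le> R) F"
    unfolding z_def by (rule residual_bounded[OF \<epsilon> u e])
  have e_pos: "eventually (\<lambda>i. e i > 0) F"
    by (rule order_tendstoD(1)[OF e \<epsilon>])
  have e_half: "eventually (\<lambda>i. e i > \<epsilon> / 2) F"
    by (rule order_tendstoD(1)[OF e]) (use \<epsilon> in simp)
  have A_bd: "eventually (\<lambda>i. norm (A i) \<le> (R / (\<epsilon> / 2)) powr (p - 1)) F"
    using R e_pos e_half
  proof eventually_elim
    case (elim i)
    then have "norm (z i) / e i \<le> R / (\<epsilon> / 2)"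
      using \<epsilon> by (intro frac_le) (auto intro: order_trans[OF norm_ge_zero])
    then show ?case
      unfolding A_def norm_env_grad[OF elim(2)] using elim p_gt_1
      by (intro powr_mono2) (simp_all add: z_def)
  qed
  define k where "k \<epsilon> = 1 / (p * \<epsilon> powr (p - 1))" for \<epsilon>
  have k_lim: "((\<lambda>i. k (e i) - k \<epsilon>) \<longlongrightarrow> 0) F"
  proof -
    have "((\<lambda>i. k (e i) - k \<epsilon>) \<longlongrightarrow> k \<epsilon> - k \<epsilon>) F"
      unfolding k_def using \<epsilon> p_gt_1 by (intro tendsto_intros e) auto
    then show ?thesis
      by simp
  qed
  \<comment> \<open>Collects the effects of moving the base point, of changing the penalty
    coefficient, and of linearizing the envelope at \<open>u0\<close>.\<close>
  define err where "err i = blinfun_apply (A i) (u i - u0) - (k (e i) - k \<epsilon>) * norm (z i) powr p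
    - blinfun_apply A0 (u i - u0)" for i
  have err_lim: "(err \<longlongrightarrow> 0) F"
  proof -
    have du: "((\<lambda>i. u i - u0) \<longlongrightarrow> 0) F"
      using u by (simp add: LIM_zero)
    have "((\<lambda>i. blinfun_apply (A i) (u i - u0)) \<longlongrightarrow> blinfun_apply 0 (0::'a)) F"
      by (rule weak_star_tendsto_apply[OF A_bd _ du]) simp
    moreover have "((\<lambda>i. (k (e i) - k \<epsilon>) * norm (z i) powr p) \<longlongrightarrow> 0) F"
    proof (rule Lim_null_comparison)
      show "eventually (\<lambda>i. norm ((k (e i) - k \<epsilon>) * norm (z i) powr p) \<le> \<bar>k (e i) - k \<epsilon>\<bar> * R powr p) F"
        using R by eventually_elim (use p_gt_1 in \<open>auto simp: abs_mult intro!: mult_left_mono powr_mono2\<close>)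
      show "((\<lambda>i. \<bar>k (e i) - k \<epsilon>\<bar> * R powr p) \<longlongrightarrow> 0) F"
        by (intro tendsto_mult_left_zero tendsto_rabs_zero k_lim)
    qed
    moreover have "((\<lambda>i. blinfun_apply A0 (u i - u0)) \<longlongrightarrow> blinfun_apply A0 0) F"
      by (intro tendsto_intros du)
    ultimately have "(err \<longlongrightarrow> blinfun_apply 0 (0::'a) - 0 - blinfun_apply A0 0) F"
      unfolding err_def by (intro tendsto_diff)
    then show ?thesis
      by simp
  qed
  \<comment> \<open>Equality in Fenchel-Young holds at the residual, so this is the convex conjugate
    of \<open>pen (e i)\<close> at \<open>A i\<close>; \<open>fenchel\<close> below is the
    inequality for all other points.\<close>
  define D where "D i = blinfun_apply (A i) (z i) - pen (e i) (z i)" for i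
  \<comment> \<open>Three inequalities are chained: the \<open>i\<close>-th resolvent competes in
    the problem with parameter \<epsilon>, the envelope lies above its linearization at
    \<open>u0\<close>, and \<open>A i\<close> is a subgradient of \<open>f\<close> tested at
    \<open>J \<epsilon> u0\<close>.\<close>
  have D_le: "eventually (\<lambda>i. D i \<le> blinfun_apply (A i) z0 - pen \<epsilon> z0 + err i) F"
    using e_pos
  proof eventually_elim
    case (elim i)
    have "pen (e i) (z i) - pen \<epsilon> (z i) = (k (e i) - k \<epsilon>) * norm (z i) powr p"
      unfolding penalty_eq[OF elim] penalty_eq[OF \<epsilon>] k_def by (simp add: left_diff_distrib)
    moreover have "env \<epsilon> (u i) \<le> pen \<epsilon> (z i) + fr (J (e i) (u i))"
      unfolding z_def by (rule env_le[OF \<epsilon> resolvent_dom[OF elim]])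
    moreover have "env \<epsilon> u0 + blinfun_apply A0 (u i - u0) \<le> env \<epsilon> (u i)"
      unfolding A0_def by (rule env_subgradient[OF \<epsilon>])
    moreover have "fr (J (e i) (u i)) + blinfun_apply (A i) (J \<epsilon> u0 - J (e i) (u i)) \<le> fr (J \<epsilon> u0)"
      unfolding A_def by (rule env_grad_subgradient_f[OF elim resolvent_dom[OF \<epsilon>]])
    ultimately show ?case
      by (simp add: D_def err_def z_def z0_def env_eq[OF \<epsilon>] blinfun.diff_right)
  qed
  have fenchel: "eventually (\<lambda>i. \<forall>y. blinfun_apply (A i) y \<le> pen (e i) y + D i) F"
    using e_pos
  proof eventually_elim
    case (elim i)
    then show ?case
      using penalty_env_grad[OF elim, of "u i"] by (simp add: D_def A_def z_def blinfun.diff_right blinfun.add_right algebra_simps)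
  qed
  have upper: "eventually (\<lambda>i. blinfun_apply (A i) h < c) F" if c: "blinfun_apply A0 h < c" for h c
  proof -
    define q where "q t = pen \<epsilon> (z0 + t *\<^sub>R h)" for t
    have "(q has_real_derivative blinfun_apply A0 h) (at 0)"
      unfolding q_def A0_def env_grad_def z0_def by (rule penalty_has_derivative[OF \<epsilon>])
    then have "((\<lambda>t. (q t - q 0) / t) \<longlongrightarrow> blinfun_apply A0 h) (at 0)"
      by (simp add: DERIV_def)
    then have "((\<lambda>t. (q t - q 0) / t) \<longlongrightarrow> blinfun_apply A0 h) (at_right 0)"
      by (rule tendsto_mono[OF at_le, rotated]) simp
    then have "eventually (\<lambda>t. (q t - q 0) / t < c) (at_right 0)"
      using c by (rule order_tendstoD)
    then have "eventually (\<lambda>t. (q t - q 0) / t < c \<and> 0 < t) (at_right 0)"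
      by (intro eventually_conj eventually_at_right_less)
    \<comment> \<open>The step t is fixed before the limit in \<open>i\<close>, so
      \<open>err i / t\<close> still vanishes.\<close>
    then obtain t where t: "(q t - q 0) / t < c" "0 < t"
      using eventually_happens'[OF trivial_limit_at_right_real] by blast
    have "((\<lambda>i. (pen (e i) (z0 + t *\<^sub>R h) - pen \<epsilon> z0 + err i) / t) \<longlongrightarrow>
        (pen \<epsilon> (z0 + t *\<^sub>R h) - pen \<epsilon> z0 + 0) / t) F"
      by (intro tendsto_divide tendsto_add tendsto_diff penalty_tendsto tendsto_const e \<epsilon> err_lim)
        (use t in simp)
    moreover have "(pen \<epsilon> (z0 + t *\<^sub>R h) - pen \<epsilon> z0 + 0) / t < c"
      using t(1) by (simp add: q_def)
    ultimately have "eventually (\<lambda>i. (pen (e i) (z0 + t *\<^sub>R h) - pen \<epsilon> z0 + err i) / t < c) F"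
      by (rule order_tendstoD)
    then show ?thesis
      using fenchel D_le
    proof eventually_elim
      case (elim i)
      have "blinfun_apply (A i) (z0 + t *\<^sub>R h) \<le> pen (e i) (z0 + t *\<^sub>R h) + D i"
        using elim(2) by blast
      then have "t * blinfun_apply (A i) h \<le> pen (e i) (z0 + t *\<^sub>R h) - pen \<epsilon> z0 + err i"
        using elim(3) by (simp add: blinfun.add_right blinfun.scaleR_right)
      then have "blinfun_apply (A i) h \<le> (pen (e i) (z0 + t *\<^sub>R h) - pen \<epsilon> z0 + err i) / t"
        using t(2) by (simp add: pos_le_divide_eq mult.commute)
      with elim(1) show ?case
        by simp
    qed
  qed
  have lim: "((\<lambda>i. blinfun_apply (A i) x) \<longlongrightarrow> blinfun_apply A0 x) F" for x
  proof (rule order_tendstoI)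
    fix c
    show "blinfun_apply A0 x < c \<Longrightarrow> eventually (\<lambda>i. blinfun_apply (A i) x < c) F"
      by (rule upper)
    \<comment> \<open>The lower bound is the upper bound in direction -x; linearity of the
      derivative \<open>A0\<close> closes the gap.\<close>
    assume "c < blinfun_apply A0 x"
    then have "eventually (\<lambda>i. blinfun_apply (A i) (- x) < - c) F"
      by (intro upper) (simp add: blinfun.minus_right)
    then show "eventually (\<lambda>i. c < blinfun_apply (A i) x) F"
      by (simp add: blinfun.minus_right)
  qed
  then show "((\<lambda>i. blinfun_apply (env_grad (e i) (u i)) x) \<longlongrightarrow> blinfun_apply (env_grad \<epsilon> u0) x) F"
    by (simp add: A_def A0_def)
  have "(D \<longlongrightarrow> blinfun_apply A0 z0 - pen \<epsilon> z0) F"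
  proof (rule tendsto_sandwich)
    show "eventually (\<lambda>i. blinfun_apply (A i) z0 - pen (e i) z0 \<le> D i) F"
      using fenchel by eventually_elim (simp add: diff_le_eq add.commute)
    show "((\<lambda>i. blinfun_apply (A i) z0 - pen (e i) z0) \<longlongrightarrow> blinfun_apply A0 z0 - pen \<epsilon> z0) F"
      by (intro tendsto_diff lim penalty_tendsto e \<epsilon> tendsto_const)
    have "((\<lambda>i. blinfun_apply (A i) z0 - pen \<epsilon> z0 + err i) \<longlongrightarrow> blinfun_apply A0 z0 - pen \<epsilon> z0 + 0) F"
      by (intro tendsto_diff tendsto_add lim err_lim tendsto_const)
    then show "((\<lambda>i. blinfun_apply (A i) z0 - pen \<epsilon> z0 + err i) \<longlongrightarrow> blinfun_apply A0 z0 - pen \<epsilon> z0) F"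
      by simp
  qed (rule D_le)
  \<comment> \<open>By Euler's identity, convergence of the conjugate values is convergence of the
    penalties, from which \<open>root\<close> recovers the norms.\<close>
  moreover have "eventually (\<lambda>i. D i = (p - 1) * pen (e i) (z i)) F"
    using e_pos
    by eventually_elim (simp add: D_def A_def z_def env_grad_apply_self left_diff_distrib)
  moreover have "blinfun_apply A0 z0 - pen \<epsilon> z0 = (p - 1) * pen \<epsilon> z0"
    using env_grad_apply_self[OF \<epsilon>] by (simp add: A0_def z0_def left_diff_distrib)
  ultimately have "((\<lambda>i. (p - 1) * pen (e i) (z i)) \<longlongrightarrow> (p - 1) * pen \<epsilon> z0) F"
    by (simp add: filterlim_cong)
  then have "((\<lambda>i. inverse (p - 1) * ((p - 1) * pen (e i) (z i))) \<longlongrightarrow>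
      inverse (p - 1) * ((p - 1) * pen \<epsilon> z0)) F"
    by (rule tendsto_mult_left)
  then have pen_lim: "((\<lambda>i. pen (e i) (z i)) \<longlongrightarrow> pen \<epsilon> z0) F"
    using p_gt_1 by (simp add: mult.assoc[symmetric])
  have root: "e * (p * pen e y / e) powr (1 / p) = norm y" if "e > 0" for e and y :: 'a
    using that p_gt_1 by (simp add: penalty_def powr_powr)
  have "((\<lambda>i. e i * (p * pen (e i) (z i) / e i) powr (1 / p)) \<longlongrightarrow>
      \<epsilon> * (p * pen \<epsilon> z0 / \<epsilon>) powr (1 / p)) F"
    using p_gt_1 \<epsilon> penalty_nonneg
    by (intro tendsto_mult tendsto_powr' tendsto_divide e pen_lim tendsto_const)
      (auto intro!: eventually_mono[OF e_pos])
  then have "((\<lambda>i. norm (z i)) \<longlongrightarrow> norm z0) F"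
    unfolding root[OF \<epsilon>]
    by (rule Lim_transform_eventually) (use e_pos in \<open>auto elim!: eventually_mono simp: root\<close>)
  then show "((\<lambda>i. norm (u i - J (e i) (u i))) \<longlongrightarrow> norm (u0 - J \<epsilon> u0)) F"
    by (simp add: z_def z0_def)
qed

lemma env_grad_demicontinuous:
  assumes "\<epsilon> > 0"
  shows "demicontinuous (env_grad \<epsilon>)"
  unfolding demicontinuous_def continuous_on_strong_operator_topo_iff_coordinatewise
    continuous_map_iff_continuous2 continuous_on_def
  using env_grad_continuous(1)[OF assms tendsto_ident_at tendsto_const] by blast

lemma env_grad_strongly_continuous:
  assumes uc: "uniformly_convex_space TYPE('a \<Rightarrow>\<^sub>L real)" and \<epsilon>: "\<epsilon> > 0"
  shows "continuous_on UNIV (env_grad \<epsilon>)"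
  unfolding continuous_on_def
proof
  fix u0 :: 'a
  have lim: "((\<lambda>u. u) \<longlongrightarrow> u0) (at u0 within UNIV)"
    by (rule tendsto_ident_at)
  have "((\<lambda>u. norm (env_grad \<epsilon> u)) \<longlongrightarrow> norm (env_grad \<epsilon> u0)) (at u0 within UNIV)"
    unfolding norm_env_grad[OF \<epsilon>] using p_gt_1 \<epsilon>
    by (intro tendsto_powr' tendsto_divide env_grad_continuous(2)[OF \<epsilon> lim tendsto_const] tendsto_const) auto
  then show "(env_grad \<epsilon> \<longlongrightarrow> env_grad \<epsilon> u0) (at u0 within UNIV)"
    by (intro radon_riesz_weak_star[OF uc] env_grad_continuous(1)[OF \<epsilon> lim tendsto_const])
qed

lemma env_gateaux:
  assumes \<epsilon>: "\<epsilon> > 0"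
  shows "has_gateaux_derivative (env \<epsilon>) (env_grad \<epsilon> u) u"
  unfolding has_gateaux_derivative_def
proof
  fix h
  have "((\<lambda>t::real. u + t *\<^sub>R h) \<longlongrightarrow> u + 0 *\<^sub>R h) (at 0)"
    by (intro tendsto_intros)
  then have "((\<lambda>t. blinfun_apply (env_grad \<epsilon> (u + t *\<^sub>R h)) h) \<longlongrightarrow> blinfun_apply (env_grad \<epsilon> u) h) (at 0)"
    by (intro env_grad_continuous(1)[OF \<epsilon> _ tendsto_const]) simp
  then show "((\<lambda>t. env \<epsilon> (u + t *\<^sub>R h)) has_real_derivative blinfun_apply (env_grad \<epsilon> u) h) (at 0)"
    by (intro subgradient_selection_derivative[where g = "env \<epsilon>"] env_subgradient[OF \<epsilon>])
qed

lemma my_derivative_eq: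
  assumes "\<epsilon> > 0"
  shows "my_derivative p f \<epsilon> = env_grad \<epsilon>"
proof
  fix u
  have "\<xi> = env_grad \<epsilon> u" if "has_gateaux_derivative (env \<epsilon>) \<xi> u" for \<xi>
    using that env_gateaux[OF assms, of u] unfolding has_gateaux_derivative_def
    by (intro blinfun_eqI) (blast intro: DERIV_unique)
  then show "my_derivative p f \<epsilon> u = env_grad \<epsilon> u"
    unfolding my_derivative_def gateaux_derivative_def using env_gateaux[OF assms] by (intro the_equality)
qed

text \<open>Each minimizer is used as competitor for the other parameter. The resulting two bounds
  differ by (k a - k b)(N a - N b), which is of smaller order because residual norms depend
  continuously on \<epsilon>.\<close>

lemma env_derivative_parameter:
  assumes \<epsilon>: "\<epsilon> > 0"
  shows "((\<lambda>\<epsilon>. env \<epsilon> u) has_real_derivative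
    - (1 / (p / (p - 1) * \<epsilon> powr p) * norm (J \<epsilon> u - u) powr p)) (at \<epsilon>)"
proof -
  define k where "k \<epsilon> = 1 / (p * \<epsilon> powr (p - 1))" for \<epsilon>
  define N where "N \<epsilon> = norm (u - J \<epsilon> u) powr p" for \<epsilon>
  define k' where "k' = - (1 / (p / (p - 1) * \<epsilon> powr p))"
  have k: "(k has_real_derivative k') (at \<epsilon>)"
  proof -
    have "((\<lambda>\<epsilon>. \<epsilon> powr (1 - p) / p) has_real_derivative (1 - p) * \<epsilon> powr (1 - p - 1) / p) (at \<epsilon>)"
      using \<epsilon> p_gt_1 by (auto intro!: derivative_eq_intros)
    moreover have "k = (\<lambda>\<epsilon>. \<epsilon> powr (1 - p) / p)"
      using p_gt_1 by (auto simp: k_def fun_eq_iff powr_diff field_simps)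
    moreover have "(1 - p) * \<epsilon> powr (1 - p - 1) / p = k'"
      using \<epsilon> p_gt_1 by (simp add: k'_def powr_minus field_simps)
    ultimately show ?thesis
      by simp
  qed
  have upper: "env a u \<le> env b u + (k a - k b) * N b" if "a > 0" "b > 0" for a b
  proof -
    have "env a u \<le> k a * N b + fr (J b u)"
      using env_le[OF that(1) resolvent_dom[OF that(2)], of u] that
      by (simp add: penalty_eq k_def N_def)
    moreover have "env b u = k b * N b + fr (J b u)"
      using that by (simp add: env_eq penalty_eq k_def N_def)
    ultimately show ?thesis
      by (simp add: left_diff_distrib)
  qed
  define Q where "Q e = (k e - k \<epsilon>) / (e - \<epsilon>)" for e
  define d where "d e = (env e u - env \<epsilon> u) / (e - \<epsilon>)" for e
  have Q: "(Q \<longlongrightarrow> k') (at \<epsilon>)"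
    using k unfolding has_field_derivative_iff Q_def .
  have "((\<lambda>e. norm (u - J e u)) \<longlongrightarrow> norm (u - J \<epsilon> u)) (at \<epsilon>)"
    by (rule env_grad_continuous(2)[OF \<epsilon> tendsto_const tendsto_ident_at])
  then have N: "(N \<longlongrightarrow> N \<epsilon>) (at \<epsilon>)"
    unfolding N_def using p_gt_1 by (intro tendsto_powr' tendsto_const) auto
  have "((\<lambda>e. d e - Q e * N \<epsilon>) \<longlongrightarrow> 0) (at \<epsilon>)"
  proof (rule Lim_null_comparison)
    have "((\<lambda>e. \<bar>Q e\<bar> * \<bar>N e - N \<epsilon>\<bar>) \<longlongrightarrow> \<bar>k'\<bar> * \<bar>N \<epsilon> - N \<epsilon>\<bar>) (at \<epsilon>)"
      by (intro tendsto_intros Q N)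
    then show "((\<lambda>e. \<bar>Q e\<bar> * \<bar>N e - N \<epsilon>\<bar>) \<longlongrightarrow> 0) (at \<epsilon>)"
      by simp
    have "eventually (\<lambda>e. 0 < e) (at \<epsilon>)"
      using \<epsilon> by (rule order_tendstoD(1)[OF tendsto_ident_at])
    moreover have "eventually (\<lambda>e. e \<noteq> \<epsilon>) (at \<epsilon>)"
      by (simp add: eventually_at_filter)
    ultimately show "eventually (\<lambda>e. norm (d e - Q e * N \<epsilon>) \<le> \<bar>Q e\<bar> * \<bar>N e - N \<epsilon>\<bar>) (at \<epsilon>)"
    proof eventually_elim
      case (elim e)
      \<comment> \<open>The error of the first-order expansion: \<open>upper\<close> for both orders
        of the parameters confines it between the mixed product and 0.\<close>
      define x where "x = env e u - env \<epsilon> u - (k e - k \<epsilon>) * N \<epsilon>"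
      have "x \<le> 0" "(k e - k \<epsilon>) * (N e - N \<epsilon>) \<le> x"
        using upper[OF elim(1) \<epsilon>] upper[OF \<epsilon> elim(1)] by (auto simp: x_def algebra_simps)
      then have "\<bar>x\<bar> \<le> \<bar>k e - k \<epsilon>\<bar> * \<bar>N e - N \<epsilon>\<bar>"
        by (simp add: abs_mult[symmetric])
      then have "\<bar>x\<bar> / \<bar>e - \<epsilon>\<bar> \<le> \<bar>k e - k \<epsilon>\<bar> * \<bar>N e - N \<epsilon>\<bar> / \<bar>e - \<epsilon>\<bar>"
        by (rule divide_right_mono) simp
      moreover have "d e - Q e * N \<epsilon> = x / (e - \<epsilon>)"
        unfolding d_def Q_def x_def by (simp add: diff_divide_distrib[of _ "_ * _"])
      ultimately show ?case
        by (simp add: Q_def abs_mult)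
    qed
  qed
  from tendsto_add[OF this tendsto_mult_right[OF Q, of "N \<epsilon>"]]
  have "(d \<longlongrightarrow> k' * N \<epsilon>) (at \<epsilon>)"
    by simp
  then have "((\<lambda>e. env e u) has_real_derivative k' * N \<epsilon>) (at \<epsilon>)"
    unfolding has_field_derivative_iff d_def .
  then show ?thesis
    by (simp add: k'_def N_def norm_minus_commute)
qed

section \<open>Convexity, Lipschitz bounds and comparison in the parameter\<close>

lemma moreau_finite: "\<epsilon> > 0 \<Longrightarrow> \<bar>moreau_yosida p f \<epsilon> u\<bar> \<noteq> \<infinity>"
  by (simp add: moreau_eq)

lemma moreau_convex:
  assumes \<epsilon>: "\<epsilon> > 0"
  shows "convex_fun (moreau_yosida p f \<epsilon>)"
  unfolding convex_fun_def
proof (intro allI ballI)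
  fix x y :: 'a and t :: real
  assume "t \<in> {0<..<1}"
  then have t: "0 < t" "t < 1"
    by auto
  have "env \<epsilon> (t *\<^sub>R x + (1 - t) *\<^sub>R y) \<le> t * env \<epsilon> x + (1 - t) * env \<epsilon> y"
    using env_le[OF \<epsilon> fr_convex(1)[OF resolvent_dom[OF \<epsilon>] resolvent_dom[OF \<epsilon>] t],
        of "t *\<^sub>R x + (1 - t) *\<^sub>R y" x y]
      objective_convex(1)[OF \<epsilon> resolvent_dom[OF \<epsilon>, of x] resolvent_dom[OF \<epsilon>, of y] t, where x = x and y = y]
    by (simp add: env_eq[OF \<epsilon>])
  then show "moreau_yosida p f \<epsilon> (t *\<^sub>R x + (1 - t) *\<^sub>R y)
      \<le> ereal t * moreau_yosida p f \<epsilon> x + ereal (1 - t) * moreau_yosida p f \<epsilon> y"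
    by (simp add: moreau_eq[OF \<epsilon>])
qed

text \<open>If the resolvents differ, strictness comes from \<open>f\<close>; if they coincide, the
  residuals differ and strictness comes from the penalty.\<close>

lemma moreau_strictly_convex:
  assumes \<epsilon>: "\<epsilon> > 0" and sc: "strictly_convex_fun f"
  shows "strictly_convex_fun (moreau_yosida p f \<epsilon>)"
  unfolding strictly_convex_fun_def
proof (intro ballI impI)
  fix x y :: 'a and t :: real
  assume "x \<noteq> y" and "t \<in> {0<..<1}"
  then have t: "0 < t" "t < 1"
    by auto
  note dom = resolvent_dom[OF \<epsilon>]
  define v where "v = t *\<^sub>R J \<epsilon> x + (1 - t) *\<^sub>R J \<epsilon> y"
  define u where "u = t *\<^sub>R x + (1 - t) *\<^sub>R y"
  have v: "v \<in> eff_dom f"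
    unfolding v_def by (intro fr_convex(1) dom t)
  have "pen \<epsilon> (u - v) + fr v
      < t * (pen \<epsilon> (x - J \<epsilon> x) + fr (J \<epsilon> x)) + (1 - t) * (pen \<epsilon> (y - J \<epsilon> y) + fr (J \<epsilon> y))"
  proof (cases "J \<epsilon> x = J \<epsilon> y")
    case True
    then show ?thesis
      unfolding u_def v_def using \<open>x \<noteq> y\<close> by (intro objective_convex(2) \<epsilon> dom t) simp
  next
    case False
    then have "f v < ereal t * f (J \<epsilon> x) + ereal (1 - t) * f (J \<epsilon> y)"
      using sc dom t unfolding strictly_convex_fun_def v_def by simp
    then have "fr v < t * fr (J \<epsilon> x) + (1 - t) * fr (J \<epsilon> y)"
      by (simp add: f_eq dom v)
    moreover have "u - v = t *\<^sub>R (x - J \<epsilon> x) + (1 - t) *\<^sub>R (y - J \<epsilon> y)"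
      by (simp add: u_def v_def algebra_simps)
    ultimately show ?thesis
      using penalty_convex[OF \<epsilon> t, of "x - J \<epsilon> x" "y - J \<epsilon> y"] by (simp add: distrib_left)
  qed
  then have "env \<epsilon> u < t * env \<epsilon> x + (1 - t) * env \<epsilon> y"
    using env_le[OF \<epsilon> v, of u] by (simp add: env_eq[OF \<epsilon>])
  then show "moreau_yosida p f \<epsilon> (t *\<^sub>R x + (1 - t) *\<^sub>R y)
      < ereal t * moreau_yosida p f \<epsilon> x + ereal (1 - t) * moreau_yosida p f \<epsilon> y"
    by (simp add: moreau_eq[OF \<epsilon>] u_def)
qed

text \<open>Bounded residuals mean bounded gradients near \<open>u\<close>, and the subgradient
  inequality used at both points gives the Lipschitz estimate.\<close>

lemma env_locally_lipschitz:
  assumes \<epsilon>: "\<epsilon> > 0"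
  shows "locally_lipschitz (env \<epsilon>)"
  unfolding locally_lipschitz_def
proof
  fix u
  obtain R where "eventually (\<lambda>w. norm (w - J \<epsilon> w) \<le> R) (nhds u)"
    by (rule residual_bounded[OF \<epsilon> filterlim_ident[of "nhds u"] tendsto_const[of \<epsilon>]]) (rule that)
  then obtain r where r: "r > 0" "\<And>w. dist w u < r \<Longrightarrow> norm (w - J \<epsilon> w) \<le> R"
    unfolding eventually_nhds_metric by blast
  define L where "L = (R / \<epsilon>) powr (p - 1)"
  have le: "env \<epsilon> x - env \<epsilon> y \<le> L * dist x y" if "x \<in> ball u r" for x y
  proof -
    have "norm (env_grad \<epsilon> x) \<le> L"
      unfolding L_def norm_env_grad[OF \<epsilon>] using r(2)[of x] that p_gt_1 \<epsilon>
      by (intro powr_mono2 divide_right_mono) (auto simp: dist_commute)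
    then have "\<bar>blinfun_apply (env_grad \<epsilon> x) (y - x)\<bar> \<le> L * norm (y - x)"
      using norm_blinfun[of "env_grad \<epsilon> x" "y - x"] mult_right_mono[of _ L "norm (y - x)"] by force
    then show ?thesis
      using env_subgradient[OF \<epsilon>, of x y] by (simp add: dist_norm norm_minus_commute)
  qed
  have "L-lipschitz_on (ball u r) (env \<epsilon>)"
  proof (rule lipschitz_onI)
    show "dist (env \<epsilon> x) (env \<epsilon> y) \<le> L * dist x y" if "x \<in> ball u r" "y \<in> ball u r" for x y
      using le[OF that(1), of y] le[OF that(2), of x] by (auto simp: dist_real_def dist_commute)
  qed (simp add: L_def)
  with r(1) show "\<exists>r>0. \<exists>L. L-lipschitz_on (ball u r) (env \<epsilon>)"
    by blast
qed

lemma env_grad_subdifferential: "\<epsilon> > 0 \<Longrightarrow> env_grad \<epsilon> u \<in> subdifferential f (J \<epsilon> u)"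
  by (simp add: subdifferential_iff resolvent_dom env_grad_subgradient_f)

lemma p_duality_map_residual: "p_duality_map p ((J \<epsilon> u - u) /\<^sub>R \<epsilon>) = {- env_grad \<epsilon> u}"
proof -
  have "(J \<epsilon> u - u) /\<^sub>R \<epsilon> = - ((u - J \<epsilon> u) /\<^sub>R \<epsilon>)"
    by (simp flip: scaleR_minus_right)
  then show ?thesis
    by (simp only: p_duality_map_eq[OF smooth p_gt_1] p_dual_minus[OF smooth p_gt_1] env_grad_def)
qed

lemma euler_lagrange:
  assumes "\<epsilon> > 0"
  shows "0 \<in> p_duality_map p ((J \<epsilon> u - u) /\<^sub>R \<epsilon>) + subdifferential f (J \<epsilon> u)"
  using set_plus_intro[OF _ env_grad_subdifferential[OF assms], of "- env_grad \<epsilon> u" "{- env_grad \<epsilon> u}" u]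
  by (simp add: p_duality_map_residual)

lemma moreau_eq_norm_env_grad:
  assumes \<epsilon>: "\<epsilon> > 0"
  shows "moreau_yosida p f \<epsilon> u = ereal (\<epsilon> / p * norm (env_grad \<epsilon> u) powr (p / (p - 1))) + f (J \<epsilon> u)"
proof -
  have "\<epsilon> / p * norm (env_grad \<epsilon> u) powr (p / (p - 1)) = pen \<epsilon> (u - J \<epsilon> u)"
    using p_gt_1 by (simp add: norm_env_grad[OF \<epsilon>] powr_powr penalty_def)
  then show ?thesis
    by (simp add: moreau_eq_objective[OF \<epsilon>] objective_eq[OF \<epsilon>])
qed

lemma f_resolvent_le_moreau: "\<epsilon> > 0 \<Longrightarrow> f (J \<epsilon> u) \<le> moreau_yosida p f \<epsilon> u"
  by (simp add: moreau_eq f_eq resolvent_dom penalty_nonneg)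

lemma moreau_antimono:
  assumes "e \<ge> \<epsilon>" "\<epsilon> > 0"
  shows "moreau_yosida p f e u \<le> moreau_yosida p f \<epsilon> u"
proof -
  have e: "e > 0"
    using assms by simp
  have "p * \<epsilon> powr (p - 1) \<le> p * e powr (p - 1)"
    using assms p_gt_1 by (intro mult_left_mono powr_mono2) auto
  then have "pen e z \<le> pen \<epsilon> z" for z
    unfolding penalty_eq[OF e] penalty_eq[OF assms(2)] using assms p_gt_1
    by (intro mult_right_mono divide_left_mono) auto
  then have "env e u \<le> env \<epsilon> u"
    using env_le[OF e resolvent_dom[OF assms(2)], of u u] unfolding env_eq[OF assms(2)]
    by (meson add_right_mono order_trans)
  then show ?thesis
    by (simp add: moreau_eq e assms(2))
qed

lemma moreau_le_f:
  assumes "\<epsilon> > 0"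
  shows "moreau_yosida p f \<epsilon> u \<le> f u"
proof (cases "u \<in> eff_dom f")
  case True
  then show ?thesis
    using env_le[OF assms True, of u] by (simp add: moreau_eq[OF assms] f_eq penalty_0)
qed (simp add: f_outside)

subsection \<open>The limit of vanishing regularization\<close>

lemma at_right_0_pos: "eventually (\<lambda>\<epsilon>::real. \<epsilon> > 0) (at_right 0)"
  by (rule eventually_at_right_less)

lemma resolvent_tendsto:
  assumes u: "u \<in> eff_dom f"
  shows "((\<lambda>\<epsilon>. J \<epsilon> u) \<longlongrightarrow> u) (at_right 0)"
proof (rule tendstoI)
  fix r :: real
  assume "r > 0"
  \<comment> \<open>The competitor \<open>u\<close> itself costs \<open>fr u\<close>, so a point
    costing one more cannot be the minimizer.\<close>
  from far_points_cost[OF this, of u "fr u + 1"] at_right_0_pos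
  show "eventually (\<lambda>\<epsilon>. dist (J \<epsilon> u) u < r) (at_right 0)"
  proof eventually_elim
    case (elim \<epsilon>)
    have "pen \<epsilon> (u - J \<epsilon> u) + fr (J \<epsilon> u) \<le> fr u"
      using resolvent_min[OF elim(2) u, of u] by (simp add: penalty_0)
    then have "\<not> r \<le> norm (u - J \<epsilon> u)"
      using elim(1) resolvent_dom[OF elim(2), of u] by force
    then show ?case
      by (simp add: dist_norm norm_minus_commute)
  qed
qed

text \<open>For the lower bound, a resolvent near \<open>u\<close> is handled by lower
  semicontinuity and one far away by \<open>far_points_cost\<close>; an infinite value
  \<open>f u\<close> needs no separate case.\<close>

lemma moreau_tendsto: "((\<lambda>\<epsilon>. moreau_yosida p f \<epsilon> u) \<longlongrightarrow> f u) (at_right 0)"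
proof (rule order_tendstoI)
  fix c
  assume "f u < c"
  show "eventually (\<lambda>\<epsilon>. moreau_yosida p f \<epsilon> u < c) (at_right 0)"
    using at_right_0_pos by eventually_elim (rule le_less_trans[OF moreau_le_f \<open>f u < c\<close>])
next
  fix c
  assume "c < f u"
  then obtain d where d: "c < ereal d" "ereal d < f u"
    using ereal_dense2 by blast
  then have "eventually (\<lambda>v. ereal d < f v) (nhds u)"
    using f_lsc unfolding lower_semicontinuous_def by blast
  then obtain r where r: "r > 0" "\<And>v. dist v u < r \<Longrightarrow> ereal d < f v"
    unfolding eventually_nhds_metric by blast
  from far_points_cost[OF r(1), of u d] at_right_0_pos
  show "eventually (\<lambda>\<epsilon>. c < moreau_yosida p f \<epsilon> u) (at_right 0)"
  proof eventually_elim
    case (elim \<epsilon>)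
    have "d \<le> pen \<epsilon> (u - J \<epsilon> u) + fr (J \<epsilon> u)"
    proof (cases "norm (u - J \<epsilon> u) \<ge> r")
      case True
      then show ?thesis
        using elim(1) resolvent_dom[OF elim(2)] by blast
    next
      case False
      then have "ereal d < f (J \<epsilon> u)"
        by (intro r(2)) (simp add: dist_norm norm_minus_commute)
      then show ?thesis
        using penalty_nonneg[OF elim(2), of "u - J \<epsilon> u"] by (simp add: f_eq resolvent_dom[OF elim(2)])
    qed
    then have "ereal d \<le> moreau_yosida p f \<epsilon> u"
      by (simp add: moreau_eq[OF elim(2)])
    with d(1) show ?case
      by (rule less_le_trans)
  qed
qed

text \<open>Monotonicity of the subdifferential between \<open>u\<close> and its resolvent compares
  the two functionals on the residual, where the gradient attains its norm.\<close>

lemma norm_env_grad_le: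
  assumes \<epsilon>: "\<epsilon> > 0" and \<xi>: "\<xi> \<in> subdifferential f u"
  shows "norm (env_grad \<epsilon> u) \<le> norm \<xi>"
proof -
  define z where "z = u - J \<epsilon> u"
  have u: "u \<in> eff_dom f"
    using \<xi> by (rule subdifferential_dom)
  have "fr u + blinfun_apply \<xi> (J \<epsilon> u - u) \<le> fr (J \<epsilon> u)"
    using \<xi> subdifferential_iff[OF u] resolvent_dom[OF \<epsilon>] by blast
  moreover have "fr (J \<epsilon> u) + blinfun_apply (env_grad \<epsilon> u) z \<le> fr u"
    unfolding z_def by (rule env_grad_subgradient_f[OF \<epsilon> u])
  ultimately have "blinfun_apply (env_grad \<epsilon> u) z \<le> blinfun_apply \<xi> z"
    by (simp add: z_def blinfun.diff_right)
  also have "\<dots> \<le> norm \<xi> * norm z"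
    using norm_blinfun[of \<xi> z] by simp
  finally have "p * pen \<epsilon> z \<le> norm \<xi> * norm z"
    by (simp add: z_def env_grad_apply_self[OF \<epsilon>])
  moreover have "p * pen \<epsilon> z = norm (env_grad \<epsilon> u) * norm z"
    using \<epsilon> p_gt_1 powr_split[of "norm z / \<epsilon>" p] unfolding norm_env_grad[OF \<epsilon>] z_def[symmetric]
    by (simp add: penalty_def)
  ultimately have le: "norm (env_grad \<epsilon> u) * norm z \<le> norm \<xi> * norm z"
    by simp
  show ?thesis
  proof (cases "z = 0")
    case True
    then show ?thesis
      using p_gt_1 by (simp add: norm_env_grad[OF \<epsilon>] z_def)
  next
    case False
    then show ?thesis
      using le by simp
  qed
qed

text \<open>A closed-graph argument: the resolvents converge in norm to \<open>u\<close> while the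
  gradients converge weak*, so the subgradient inequality at the resolvents passes to the
  limit.\<close>

lemma env_grad_cluster:
  assumes u: "u \<in> eff_dom f" and G: "G \<le> at_right 0" "G \<noteq> bot"
    and bd: "\<And>\<epsilon>. \<epsilon> > 0 \<Longrightarrow> norm (env_grad \<epsilon> u) \<le> M"
    and lim: "\<And>x. ((\<lambda>\<epsilon>. blinfun_apply (env_grad \<epsilon> u) x) \<longlongrightarrow> blinfun_apply \<eta> x) G"
  shows "\<eta> \<in> subdifferential f u"
  unfolding subdifferential_iff[OF u]
proof
  fix w
  assume w: "w \<in> eff_dom f"
  have pos: "eventually (\<lambda>\<epsilon>. \<epsilon> > 0) G"
    using at_right_0_pos G(1) filter_leD by blast
  have bdG: "eventually (\<lambda>\<epsilon>. norm (env_grad \<epsilon> u) \<le> M) G"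
    using pos by eventually_elim (rule bd)
  have J: "((\<lambda>\<epsilon>. J \<epsilon> u) \<longlongrightarrow> u) G"
    using resolvent_tendsto[OF u] G(1) by (rule tendsto_mono[rotated])
  have A: "((\<lambda>\<epsilon>. fr w - blinfun_apply (env_grad \<epsilon> u) (w - J \<epsilon> u)) \<longlongrightarrow> fr w - blinfun_apply \<eta> (w - u)) G"
    by (intro tendsto_diff tendsto_const weak_star_tendsto_apply[OF bdG lim] J)
  \<comment> \<open>Lower semicontinuity is available only through levels strictly below
    \<open>fr u\<close>; \<open>dense_le\<close> then reaches \<open>fr u\<close>.\<close>
  have "c \<le> fr w - blinfun_apply \<eta> (w - u)" if c: "c < fr u" for c
  proof (rule tendsto_lowerbound[OF A _ G(2)])
    have "eventually (\<lambda>v. ereal c < f v) (nhds u)"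
      using f_lsc c f_eq[OF u] unfolding lower_semicontinuous_def by simp
    then have "eventually (\<lambda>\<epsilon>. ereal c < f (J \<epsilon> u)) G"
      using J unfolding filterlim_iff by blast
    then show "eventually (\<lambda>\<epsilon>. c \<le> fr w - blinfun_apply (env_grad \<epsilon> u) (w - J \<epsilon> u)) G"
      using pos
    proof eventually_elim
      case (elim \<epsilon>)
      then show ?case
        using env_grad_subgradient_f[OF elim(2) w, of u] f_eq[OF resolvent_dom[OF elim(2)], of u] by simp
    qed
  qed
  then have "fr u \<le> fr w - blinfun_apply \<eta> (w - u)"
    by (rule dense_le)
  then show "fr u + blinfun_apply \<eta> (w - u) \<le> fr w"
    by simp
qed

text \<open>The midpoint of two least-norm subgradients is again a subgradient, and strict convexity
  of the p-th power of the dual norm would make it smaller.\<close>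

lemma minimal_subgradient_unique:
  assumes sc: "strictly_convex_space TYPE('a \<Rightarrow>\<^sub>L real)"
    and \<xi>: "is_arg_min norm (\<lambda>\<xi>. \<xi> \<in> subdifferential f u) \<xi>"
    and \<zeta>: "is_arg_min norm (\<lambda>\<xi>. \<xi> \<in> subdifferential f u) \<zeta>"
  shows "\<xi> = \<zeta>"
proof (rule ccontr)
  assume ne: "\<xi> \<noteq> \<zeta>"
  have sub: "\<xi> \<in> subdifferential f u" "\<zeta> \<in> subdifferential f u"
    and n: "norm \<xi> = norm \<zeta>" and least: "\<And>\<eta>. \<eta> \<in> subdifferential f u \<Longrightarrow> norm \<xi> \<le> norm \<eta>"
    using \<xi> \<zeta> by (auto simp: is_arg_min_linorder intro: antisym)
  have u: "u \<in> eff_dom f"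
    using sub(1) by (rule subdifferential_dom)
  define \<eta> where "\<eta> = (1/2) *\<^sub>R \<xi> + (1 - 1/2) *\<^sub>R \<zeta>"
  have "\<eta> \<in> subdifferential f u"
    unfolding subdifferential_iff[OF u]
  proof
    fix w
    assume "w \<in> eff_dom f"
    then have "fr u + blinfun_apply \<xi> (w - u) \<le> fr w" "fr u + blinfun_apply \<zeta> (w - u) \<le> fr w"
      using sub subdifferential_iff[OF u] by blast+
    then show "fr u + blinfun_apply \<eta> (w - u) \<le> fr w"
      by (simp add: \<eta>_def blinfun.add_left blinfun.scaleR_left)
  qed
  then have "norm \<xi> \<le> norm \<eta>"
    by (rule least)
  then have "norm \<xi> powr p \<le> norm \<eta> powr p"
    using p_gt_1 by (intro powr_mono2) auto
  moreover have "norm \<eta> powr p < norm \<xi> powr p"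
    using norm_powr_strictly_convex[OF sc p_gt_1 ne, of "1/2"] n by (simp add: \<eta>_def)
  ultimately show False
    by simp
qed

text \<open>Existence of a least-norm subgradient is a by-product: any weak* cluster point of the
  gradients is one, and Banach-Alaoglu provides such a point.\<close>

lemma minimal_subgradient_limit:
  assumes sc: "strictly_convex_space TYPE('a \<Rightarrow>\<^sub>L real)" and u: "u \<in> subdiff_dom f"
  shows "\<exists>!\<xi>. is_arg_min norm (\<lambda>\<xi>. \<xi> \<in> subdifferential f u) \<xi>"
    and "is_arg_min norm (\<lambda>\<xi>. \<xi> \<in> subdifferential f u) (minimal_subgradient f u)"
    and "((\<lambda>\<epsilon>. blinfun_apply (env_grad \<epsilon> u) x) \<longlongrightarrow> blinfun_apply (minimal_subgradient f u) x) (at_right 0)"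
    and "((\<lambda>\<epsilon>. norm (env_grad \<epsilon> u)) \<longlongrightarrow> norm (minimal_subgradient f u)) (at_right 0)"
proof -
  obtain \<xi> where \<xi>: "\<xi> \<in> subdifferential f u"
    using u by (auto simp: subdiff_dom_def)
  have dom: "u \<in> eff_dom f"
    using \<xi> by (rule subdifferential_dom)
  have bd: "eventually (\<lambda>\<epsilon>. norm (env_grad \<epsilon> u) \<le> norm \<xi>) (at_right 0)" if "\<xi> \<in> subdifferential f u" for \<xi>
    using at_right_0_pos by eventually_elim (rule norm_env_grad_le[OF _ that])
  have least: "is_arg_min norm (\<lambda>\<xi>. \<xi> \<in> subdifferential f u) \<eta>"
    if G: "G \<le> at_right 0" "G \<noteq> bot"
      and lim: "\<And>x. ((\<lambda>\<epsilon>. blinfun_apply (env_grad \<epsilon> u) x) \<longlongrightarrow> blinfun_apply \<eta> x) G" for G \<eta>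
  proof -
    have "\<eta> \<in> subdifferential f u"
      by (rule env_grad_cluster[OF dom G norm_env_grad_le[OF _ \<xi>] lim])
    moreover have "norm \<eta> \<le> norm \<zeta>" if "\<zeta> \<in> subdifferential f u" for \<zeta>
    proof (rule norm_blinfun_bound)
      fix x
      have "eventually (\<lambda>\<epsilon>. norm (blinfun_apply (env_grad \<epsilon> u) x) \<le> norm \<zeta> * norm x) G"
        using filter_leD[OF G(1) bd[OF that]]
        by eventually_elim (rule order_trans[OF norm_blinfun mult_right_mono[OF _ norm_ge_zero]])
      then show "norm (blinfun_apply \<eta> x) \<le> norm \<zeta> * norm x"
        using tendsto_upperbound[OF tendsto_norm[OF lim]] G(2) by blast
    qed simp
    ultimately show ?thesis
      by (simp add: is_arg_min_linorder)
  qed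
  obtain G \<eta> where G: "G \<le> at_right (0::real)" "G \<noteq> bot"
    and lim: "\<And>x. ((\<lambda>\<epsilon>. blinfun_apply (env_grad \<epsilon> u) x) \<longlongrightarrow> blinfun_apply \<eta> x) G"
    by (rule banach_alaoglu_filter[OF trivial_limit_at_right_real bd[OF \<xi>]]) (rule that)
  have \<eta>: "is_arg_min norm (\<lambda>\<xi>. \<xi> \<in> subdifferential f u) \<eta>"
    by (rule least[OF G lim])
  then show "\<exists>!\<xi>. is_arg_min norm (\<lambda>\<xi>. \<xi> \<in> subdifferential f u) \<xi>"
    using minimal_subgradient_unique[OF sc] by blast
  show min: "is_arg_min norm (\<lambda>\<xi>. \<xi> \<in> subdifferential f u) (minimal_subgradient f u)"
    unfolding minimal_subgradient_def arg_min_def using \<eta> by (rule someI)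
  show lim': "((\<lambda>\<epsilon>. blinfun_apply (env_grad \<epsilon> u) x) \<longlongrightarrow> blinfun_apply (minimal_subgradient f u) x) (at_right 0)" for x
    by (rule weak_star_limit_unique_cluster[OF bd[OF \<xi>]])
      (rule minimal_subgradient_unique[OF sc least min])
  show "((\<lambda>\<epsilon>. norm (env_grad \<epsilon> u)) \<longlongrightarrow> norm (minimal_subgradient f u)) (at_right 0)"
    using weak_star_norm_tendsto[OF lim' bd] min by (simp add: is_arg_min_def)
qed

end

theorem theorem2p2:
  fixes f :: "'a::banach \<Rightarrow> ereal" and p p' :: real
  assumes "reflexive_space TYPE('a)"
    and "strictly_convex_space TYPE('a)" and "smooth_space TYPE('a)"
    and "strictly_convex_space TYPE('a \<Rightarrow>\<^sub>L real)" and "smooth_space TYPE('a \<Rightarrow>\<^sub>L real)"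
    and "p > 1" and "p' = p / (p - 1)"
    and "\<And>u. f u \<noteq> -\<infinity>" and "proper_fun f" and "lower_semicontinuous f" and "convex_fun f"
  shows
    "(\<forall>\<epsilon>>0.
        (\<forall>u. moreau_yosida p f \<epsilon> u = (INF v. my_objective p f \<epsilon> u v)) \<and>
        (\<forall>u. \<bar>moreau_yosida p f \<epsilon> u\<bar> \<noteq> \<infinity>) \<and>
        convex_fun (moreau_yosida p f \<epsilon>) \<and>
        locally_lipschitz (\<lambda>u. real_of_ereal (moreau_yosida p f \<epsilon> u)) \<and>
        (strictly_convex_fun f \<longrightarrow> strictly_convex_fun (moreau_yosida p f \<epsilon>)))
     \<and>
     (\<forall>\<epsilon>>0. \<forall>u.
        (\<exists>!v. is_arg_min (my_objective p f \<epsilon> u) (\<lambda>_. True) v) \<and>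
        is_arg_min (my_objective p f \<epsilon> u) (\<lambda>_. True) (my_resolvent p f \<epsilon> u) \<and>
        moreau_yosida p f \<epsilon> u = my_objective p f \<epsilon> u (my_resolvent p f \<epsilon> u) \<and>
        0 \<in> p_duality_map p ((my_resolvent p f \<epsilon> u - u) /\<^sub>R \<epsilon>)
              + subdifferential f (my_resolvent p f \<epsilon> u))
     \<and>
     (\<forall>\<epsilon>>0.
        (\<forall>u. has_gateaux_derivative (\<lambda>w. real_of_ereal (moreau_yosida p f \<epsilon> w))
               (my_derivative p f \<epsilon> u) u) \<and>
        demicontinuous (my_derivative p f \<epsilon>) \<and>
        (\<forall>u. p_duality_map p ((my_resolvent p f \<epsilon> u - u) /\<^sub>R \<epsilon>) = {- my_derivative p f \<epsilon> u}) \<and>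
        (uniformly_convex_space TYPE('a \<Rightarrow>\<^sub>L real) \<longrightarrow>
           continuous_on UNIV (my_derivative p f \<epsilon>)))
     \<and>
     (\<forall>\<epsilon>>0. \<forall>u. moreau_yosida p f \<epsilon> u =
        ereal (\<epsilon> / p * norm (my_derivative p f \<epsilon> u) powr p') + f (my_resolvent p f \<epsilon> u))
     \<and>
     (\<forall>u \<epsilon>\<^sub>1 \<epsilon>\<^sub>2. \<epsilon>\<^sub>1 \<ge> \<epsilon>\<^sub>2 \<and> \<epsilon>\<^sub>2 > 0 \<longrightarrow>
        f (my_resolvent p f \<epsilon>\<^sub>1 u) \<le> moreau_yosida p f \<epsilon>\<^sub>1 u \<and>
        moreau_yosida p f \<epsilon>\<^sub>1 u \<le> moreau_yosida p f \<epsilon>\<^sub>2 u \<and>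
        moreau_yosida p f \<epsilon>\<^sub>2 u \<le> f u)
     \<and>
     (\<forall>u\<in>eff_dom f. ((\<lambda>\<epsilon>. norm (my_resolvent p f \<epsilon> u - u)) \<longlongrightarrow> 0) (at_right 0))
     \<and>
     (\<forall>u. ((\<lambda>\<epsilon>. moreau_yosida p f \<epsilon> u) \<longlongrightarrow> f u) (at_right 0))
     \<and>
     (\<forall>u\<in>subdiff_dom f.
        (\<exists>!\<xi>. is_arg_min norm (\<lambda>\<xi>. \<xi> \<in> subdifferential f u) \<xi>) \<and>
        minimal_subgradient f u \<in> subdifferential f u \<and>
        weakly_tendsto (\<lambda>\<epsilon>. my_derivative p f \<epsilon> u) (minimal_subgradient f u) (at_right 0) \<and>
        (uniformly_convex_space TYPE('a \<Rightarrow>\<^sub>L real) \<longrightarrow>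
           ((\<lambda>\<epsilon>. my_derivative p f \<epsilon> u) \<longlongrightarrow> minimal_subgradient f u) (at_right 0)))
     \<and>
     (\<forall>u. \<forall>\<epsilon>>0. ((\<lambda>\<epsilon>. real_of_ereal (moreau_yosida p f \<epsilon> u)) has_real_derivative
        - (1 / (p' * \<epsilon> powr p) * norm (my_resolvent p f \<epsilon> u - u) powr p)) (at \<epsilon>))"
proof -
  interpret regularization f p
    using assms by unfold_locales auto
  have "moreau_yosida p f \<epsilon> u = (INF v. my_objective p f \<epsilon> u v)"
    "\<bar>moreau_yosida p f \<epsilon> u\<bar> \<noteq> \<infinity>"
    "convex_fun (moreau_yosida p f \<epsilon>)"
    "locally_lipschitz (\<lambda>u. real_of_ereal (moreau_yosida p f \<epsilon> u))"
    "strictly_convex_fun f \<longrightarrow> strictly_convex_fun (moreau_yosida p f \<epsilon>)" if \<epsilon>: "\<epsilon> > 0" for \<epsilon> u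
    by (rule moreau_eq_INF[OF \<epsilon>] moreau_finite[OF \<epsilon>] moreau_convex[OF \<epsilon>] env_locally_lipschitz[OF \<epsilon>]
        impI[OF moreau_strictly_convex[OF \<epsilon>]]; assumption?)+
  note 1 = this
  have "\<exists>!v. is_arg_min (my_objective p f \<epsilon> u) (\<lambda>_. True) v"
    "is_arg_min (my_objective p f \<epsilon> u) (\<lambda>_. True) (my_resolvent p f \<epsilon> u)"
    "moreau_yosida p f \<epsilon> u = my_objective p f \<epsilon> u (my_resolvent p f \<epsilon> u)"
    "0 \<in> p_duality_map p ((my_resolvent p f \<epsilon> u - u) /\<^sub>R \<epsilon>) + subdifferential f (my_resolvent p f \<epsilon> u)"
    if "\<epsilon> > 0" for \<epsilon> u
    using that by (intro ex1_minimizer resolvent_is_arg_min moreau_eq_objective euler_lagrange; assumption)+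
  note 2 = this
  have "has_gateaux_derivative (\<lambda>w. real_of_ereal (moreau_yosida p f \<epsilon> w)) (my_derivative p f \<epsilon> u) u"
    "demicontinuous (my_derivative p f \<epsilon>)"
    "p_duality_map p ((my_resolvent p f \<epsilon> u - u) /\<^sub>R \<epsilon>) = {- my_derivative p f \<epsilon> u}"
    "uniformly_convex_space TYPE('a \<Rightarrow>\<^sub>L real) \<longrightarrow> continuous_on UNIV (my_derivative p f \<epsilon>)"
    if \<epsilon>: "\<epsilon> > 0" for \<epsilon> u
    unfolding my_derivative_eq[OF \<epsilon>]
    by (rule env_gateaux[OF \<epsilon>] env_grad_demicontinuous[OF \<epsilon>] p_duality_map_residual
        impI[OF env_grad_strongly_continuous[OF _ \<epsilon>]]; assumption?)+
  note 3 = this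
  have "moreau_yosida p f \<epsilon> u =
      ereal (\<epsilon> / p * norm (my_derivative p f \<epsilon> u) powr p') + f (my_resolvent p f \<epsilon> u)" if "\<epsilon> > 0" for \<epsilon> u
    unfolding my_derivative_eq[OF that] assms(7) by (rule moreau_eq_norm_env_grad[OF that])
  note 4 = this
  have "f (my_resolvent p f \<epsilon>\<^sub>1 u) \<le> moreau_yosida p f \<epsilon>\<^sub>1 u"
    "moreau_yosida p f \<epsilon>\<^sub>1 u \<le> moreau_yosida p f \<epsilon>\<^sub>2 u" "moreau_yosida p f \<epsilon>\<^sub>2 u \<le> f u"
    if "\<epsilon>\<^sub>1 \<ge> \<epsilon>\<^sub>2 \<and> \<epsilon>\<^sub>2 > 0" for u \<epsilon>\<^sub>1 \<epsilon>\<^sub>2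
    using that by (auto intro: f_resolvent_le_moreau moreau_antimono moreau_le_f)
  note 5 = this
  have "((\<lambda>\<epsilon>. norm (my_resolvent p f \<epsilon> u - u)) \<longlongrightarrow> 0) (at_right 0)" if "u \<in> eff_dom f" for u
    using resolvent_tendsto[OF that] by (simp add: tendsto_norm_zero_iff LIM_zero_iff)
  note 6 = this
  \<comment> \<open>\<open>my_derivative\<close> is identified with \<open>env_grad\<close> for
    positive \<epsilon>, which is all that \<open>at_right 0\<close> sees.\<close>
  have deriv_lim: "(\<phi> \<longlongrightarrow> l) (at_right 0) \<longleftrightarrow> (\<psi> \<longlongrightarrow> l) (at_right 0)"
    if "\<And>\<epsilon>. \<epsilon> > 0 \<Longrightarrow> \<phi> \<epsilon> = \<psi> \<epsilon>" for \<phi> \<psi> :: "real \<Rightarrow> 'b::topological_space" and l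
    using at_right_0_pos by (intro filterlim_cong refl) (auto elim!: eventually_mono simp: that)
  have "(\<exists>!\<xi>. is_arg_min norm (\<lambda>\<xi>. \<xi> \<in> subdifferential f u) \<xi>)"
    "minimal_subgradient f u \<in> subdifferential f u"
    "weakly_tendsto (\<lambda>\<epsilon>. my_derivative p f \<epsilon> u) (minimal_subgradient f u) (at_right 0)"
    "uniformly_convex_space TYPE('a \<Rightarrow>\<^sub>L real) \<longrightarrow>
      ((\<lambda>\<epsilon>. my_derivative p f \<epsilon> u) \<longlongrightarrow> minimal_subgradient f u) (at_right 0)"
    if u: "u \<in> subdiff_dom f" for u
  proof -
    note lim = minimal_subgradient_limit[OF assms(4) u]
    show "\<exists>!\<xi>. is_arg_min norm (\<lambda>\<xi>. \<xi> \<in> subdifferential f u) \<xi>"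
      by (rule lim(1))
    show "minimal_subgradient f u \<in> subdifferential f u"
      using lim(2) by (simp add: is_arg_min_def)
    show "weakly_tendsto (\<lambda>\<epsilon>. my_derivative p f \<epsilon> u) (minimal_subgradient f u) (at_right 0)"
      unfolding weakly_tendsto_def
    proof
      \<comment> \<open>Weak convergence in the dual tests against the bidual; by reflexivity each
        test functional is evaluation at a point, so the weak* limit suffices.\<close>
      fix \<Phi> :: "('a \<Rightarrow>\<^sub>L real) \<Rightarrow>\<^sub>L real"
      obtain x where x: "\<And>\<xi>. blinfun_apply \<Phi> \<xi> = blinfun_apply \<xi> x"
        using assms(1) unfolding reflexive_space_def by blast
      show "((\<lambda>\<epsilon>. blinfun_apply \<Phi> (my_derivative p f \<epsilon> u)) \<longlongrightarrow> blinfun_apply \<Phi> (minimal_subgradient f u)) (at_right 0)"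
        unfolding x using lim(3)[of x] by (subst deriv_lim) (simp_all add: my_derivative_eq)
    qed
    show "uniformly_convex_space TYPE('a \<Rightarrow>\<^sub>L real) \<longrightarrow>
        ((\<lambda>\<epsilon>. my_derivative p f \<epsilon> u) \<longlongrightarrow> minimal_subgradient f u) (at_right 0)"
    proof
      assume uc: "uniformly_convex_space TYPE('a \<Rightarrow>\<^sub>L real)"
      have "((\<lambda>\<epsilon>. env_grad \<epsilon> u) \<longlongrightarrow> minimal_subgradient f u) (at_right 0)"
        by (rule radon_riesz_weak_star[OF uc lim(3,4)])
      then show "((\<lambda>\<epsilon>. my_derivative p f \<epsilon> u) \<longlongrightarrow> minimal_subgradient f u) (at_right 0)"
        by (subst deriv_lim) (simp_all add: my_derivative_eq)
    qed
  qed
  note 7 = this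
  have "((\<lambda>\<epsilon>. real_of_ereal (moreau_yosida p f \<epsilon> u)) has_real_derivative
      - (1 / (p' * \<epsilon> powr p) * norm (my_resolvent p f \<epsilon> u - u) powr p)) (at \<epsilon>)" if "\<epsilon> > 0" for u \<epsilon>
    unfolding assms(7) by (rule env_derivative_parameter[OF that])
  note 8 = this
  show ?thesis
    by (intro conjI allI impI ballI;
        rule 1[rule_format] 2 3[rule_format] 4 5 6 moreau_tendsto 7[rule_format] 8; assumption)
qed

end
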